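(* Let $p^*_\infty\in\arg\max_{p\ge0}p\,\overline{G}(p)$ and $p^*_K\in\arg\max_{p>0}R(K,p\mathbf 1)$ be optimal uniform prices of the infinite-server system and of the $K$-server system respectively, and let $\mathbf p^*\in\mathbb{R}_+^{\{0,\dots,K-1\}}$ be an optimal state-dependent price vector for the $K$-server system, i.e. $R(K,\mathbf p^* )=\max_{\mathbf p}R(K,\mathbf p)$. If $\pi_K(p^*_\infty)$ denotes the blocking probability of the $K$-server system under the uniform price $p^*_\infty$, then $$R(K,p^*_K\mathbf 1)\;\le\;R(K,\mathbf p^* )\;\le\;\frac{R(K,p^*_K\mathbf 1)}{1-\pi_K(p^*_\infty)}.$$
   Context: $K$-server pricing system ($K\in\mathbb{N}$): jobs arrive at times $A_n=\sum_{i=1}^n U_i$, where the $U_n\ge0$ are i.i.d. with mean $1/\lambda\in(0,\infty)$. Job $n$ has service time $S_n$ (i.i.d. exponential with mean $1/\mu$) and valuation $V_n$ (i.i.d., positive, with continuous distribution function $G$ and finite mean); $(U_n),(S_n),(V_n)$ are mutually independent. $\overline{G}(u)=P(V_1\ge u)$. Given a price vector $\mathbf p=(p_0,\dots,p_{K-1})\in\mathbb{R}_+^{K}$: if job $n$ finds $Z_n=k$ busy servers on arrival, it is admitted to an idle server and pays $p_k$ if $k\le K-1$ and $V_n\ge p_k$; otherwise (price too high, or $k=K$) it leaves forever, paying nothing. Admitted jobs leave upon service completion. With $N_t$ the number of arrivals in $[0,t]$, the cumulative revenue is $R(t)=\sum_{n=1}^{N_t}\sum_{k=0}^{K-1}p_k\mathbf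 1_{\{V_n\ge p_k\}}\mathbf 1_{\{Z_n=k\}}$, and the revenue rate is $R(K,\mathbf p)=\lim_{t\to\infty}\mathbb{E}R(t)/t$. $p\mathbf 1$ is the uniform price vector $(p,\dots,p)$. $\pi_K(p)$ is the limiting (stationary) probability that an arriving job finds all $K$ servers busy under the price $p\mathbf 1$. Standing assumption: a finite optimal price vector $\mathbf p^*$ exists. *)

theory Defs
  imports "HOL-Probability.Probability"
begin

text \<open>
  Jobs are numbered from 0: job \<open>n\<close> arrives at time \<open>u 0 + ... + u n\<close>, requires service \<open>s n\<close>
  and has valuation \<open>v n\<close>. Price vectors are functions on \<open>nat\<close> of which only the values below
  the number \<open>K\<close> of servers are used.
\<close>

definition arrival :: "(nat \<Rightarrow> real) \<Rightarrow> nat \<Rightarrow> real" where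
  "arrival u n = (\<Sum>i\<le>n. u i)"

definition num_arrivals :: "(nat \<Rightarrow> real) \<Rightarrow> real \<Rightarrow> nat" where
  "num_arrivals u t = card {n. arrival u n \<in> {0..t}}"

text \<open>
  The number of jobs of \<open>J\<close> still in service when job \<open>n\<close> arrives. There is no waiting, so an
  admitted job \<open>m\<close> departs at time \<open>arrival u m + s m\<close>; a departure exactly at the arrival of
  job \<open>n\<close> has already freed its server (a null event for exponential services).
\<close>

definition in_service :: "(nat \<Rightarrow> real) \<Rightarrow> (nat \<Rightarrow> real) \<Rightarrow> nat set \<Rightarrow> nat \<Rightarrow> nat" where
  "in_service u s J n = card {m \<in> J. arrival u n < arrival u m + s m}"

text \<open>The jobs with number below \<open>n\<close> that are admitted, in a system that is initially empty.\<close>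

primrec admitted ::
  "nat \<Rightarrow> (nat \<Rightarrow> real) \<Rightarrow> (nat \<Rightarrow> real) \<Rightarrow> (nat \<Rightarrow> real) \<Rightarrow> (nat \<Rightarrow> real) \<Rightarrow> nat \<Rightarrow> nat set"
where
  "admitted K p u s v 0 = {}"
| "admitted K p u s v (Suc n) =
     (let J = admitted K p u s v n; k = in_service u s J n
      in if k < K \<and> p k \<le> v n then insert n J else J)"

definition busy ::
  "nat \<Rightarrow> (nat \<Rightarrow> real) \<Rightarrow> (nat \<Rightarrow> real) \<Rightarrow> (nat \<Rightarrow> real) \<Rightarrow> (nat \<Rightarrow> real) \<Rightarrow> nat \<Rightarrow> nat"
where
  "busy K p u s v n = in_service u s (admitted K p u s v n) n"

definition revenue ::
  "nat \<Rightarrow> (nat \<Rightarrow> real) \<Rightarrow> (nat \<Rightarrow> real) \<Rightarrow> (nat \<Rightarrow> real) \<Rightarrow> (nat \<Rightarrow> real) \<Rightarrow> real \<Rightarrow> real"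
where
  "revenue K p u s v t =
     (\<Sum>n<num_arrivals u t. \<Sum>k<K. p k * of_bool (p k \<le> v n) * of_bool (busy K p u s v n = k))"

locale pricing_system = prob_space M for M :: "'a measure" +
  fixes lam \<mu> :: real
    and U S V :: "nat \<Rightarrow> 'a \<Rightarrow> real"
  assumes lam_pos: "0 < lam" and mu_pos: "0 < \<mu>"
    \<comment> \<open>independence within each of the three sequences as well as between them\<close>
    and indep: "indep_vars (\<lambda>_. borel) (case_sum U (case_sum S V)) UNIV"
    and U_ident: "\<And>n. distr M borel (U n) = distr M borel (U 0)"
    and U_nonneg: "\<And>n. AE \<omega> in M. 0 \<le> U n \<omega>"
    and U_integrable: "integrable M (U 0)"
    and U_mean: "expectation (U 0) = 1 / lam"
    and S_exponential: "\<And>n. distributed M lborel (S n) (exponential_density \<mu>)"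
    and V_ident: "\<And>n. distr M borel (V n) = distr M borel (V 0)"
    and V_pos: "\<And>n. AE \<omega> in M. 0 < V n \<omega>"
    and V_cdf_continuous: "continuous_on UNIV (cdf (distr M borel (V 0)))"
    and V_integrable: "integrable M (V 0)"

definition G_bar :: "'a measure \<Rightarrow> (nat \<Rightarrow> 'a \<Rightarrow> real) \<Rightarrow> real \<Rightarrow> real" where
  "G_bar M V x = measure M {\<omega> \<in> space M. x \<le> V 0 \<omega>}"

text \<open>
  The limits below are unspecified when they do not exist; existence is a property of the model and
  not part of the assumptions.
\<close>

definition revenue_rate ::
  "'a measure \<Rightarrow> (nat \<Rightarrow> 'a \<Rightarrow> real) \<Rightarrow> (nat \<Rightarrow> 'a \<Rightarrow> real) \<Rightarrow> (nat \<Rightarrow> 'a \<Rightarrow> real)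
    \<Rightarrow> nat \<Rightarrow> (nat \<Rightarrow> real) \<Rightarrow> real"
where
  "revenue_rate M U S V K p =
     Lim at_top
       (\<lambda>t::real. (\<integral>\<omega>. revenue K p (\<lambda>n. U n \<omega>) (\<lambda>n. S n \<omega>) (\<lambda>n. V n \<omega>) t \<partial>M) / t)"

definition uniform_price :: "real \<Rightarrow> nat \<Rightarrow> real" where
  "uniform_price x = (\<lambda>k. x)"

definition blocking_prob ::
  "'a measure \<Rightarrow> (nat \<Rightarrow> 'a \<Rightarrow> real) \<Rightarrow> (nat \<Rightarrow> 'a \<Rightarrow> real) \<Rightarrow> (nat \<Rightarrow> 'a \<Rightarrow> real)
    \<Rightarrow> nat \<Rightarrow> real \<Rightarrow> real"
where
  "blocking_prob M U S V K x =
     lim (\<lambda>n. measure M {\<omega> \<in> space M.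
       busy K (uniform_price x) (\<lambda>i. U i \<omega>) (\<lambda>i. S i \<omega>) (\<lambda>i. V i \<omega>) n = K})"

end

theory Submission
  imports Defs
begin

text \<open>
  The number of busy servers found by the arriving jobs is a finite Markov chain: by the memoryless
  property each job present survives an interarrival time \<open>u\<close> independently with probability
  \<open>exp (- \<mu> * u)\<close>. Since interarrival times have positive mean, the chain enters state 0 from any
  state with probability bounded below, so its law converges and its Poisson equation is solvable.
  Optional stopping at the renewal counting process and the elementary renewal theorem then show
  that the revenue rate exists and equals \<open>lam * (\<Sum>k<K. \<pi> k * p k * G (p k))\<close> with \<open>\<pi>\<close> the
  stationary law and \<open>G\<close> the survival function of the valuations. Every term \<open>p k * G (p k)\<close> is at
  most \<open>g = p_inf * G p_inf\<close>, so no price vector earns more than \<open>lam * g\<close>, while the uniform price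
  \<open>p_inf\<close> earns exactly \<open>lam * g\<close> times the probability of not being blocked.
\<close>

subsection \<open>Finite chains with a state that is reached from everywhere\<close>

text \<open>With general interarrival times the number of busy servers need not be Markov in
  continuous time, and the number of arrivals up to \<open>t\<close> depends on the same
  interarrival times that drive the embedded chain. The expected revenue is therefore not simply an
  expected count times a mean payment. The Poisson equation removes this coupling: revenue minus
  \<open>c\<close> times the count becomes a telescoping sum whose expectation stays bounded in
  \<open>t\<close>, so only the linear growth of the expected count is needed, and that holds for
  lattice laws too. Existence of both limits has to be proved, since \<open>Lim\<close> and
  \<open>lim\<close> say nothing otherwise. Memorylessness concerns individual jobs of known age, so
  the state is refined to the set \<open>serving\<close> and summed over sets of equal size in the
  end. Conditioning is replaced throughout by integrating out single coordinates of a product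
  space.\<close>

text \<open>Subtracting \<open>e\<close> times the point mass at state 0 from each row of \<open>P\<close> leaves a kernel \<open>T\<close>
  with row sums \<open>1 - e\<close>. Its Neumann series solves the Poisson equation, and \<open>e * s 0\<close> is the
  stationary mean.\<close>

lemma doeblin_poisson_equation:
  fixes P :: "nat \<Rightarrow> nat \<Rightarrow> real" and r :: "nat \<Rightarrow> real"
  assumes nonneg: "\<And>k j. k \<le> K \<Longrightarrow> j \<le> K \<Longrightarrow> 0 \<le> P k j"
    and row: "\<And>k. k \<le> K \<Longrightarrow> (\<Sum>j\<le>K. P k j) = 1"
    and e: "0 < e" "\<And>k. k \<le> K \<Longrightarrow> e \<le> P k 0"
  shows "\<exists>s c. (\<forall>k\<le>K. s k - (\<Sum>j\<le>K. P k j * s j) = r k - c) \<and>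
    (\<forall>a. (\<forall>n. \<forall>j\<le>K. a (Suc n) j = (\<Sum>k\<le>K. a n k * P k j)) \<longrightarrow> (\<forall>n. (\<Sum>k\<le>K. a n k) = 1) \<longrightarrow>
      (\<lambda>n. \<Sum>k\<le>K. a n k * r k) \<longlonglongrightarrow> c)"
proof -
  define T where "T h k = (\<Sum>j\<le>K. P k j * h j) - e * h 0" for h :: "nat \<Rightarrow> real" and k
  define q where "q = 1 - e"
  have T_alt: "T h k = (\<Sum>j\<le>K. (P k j - e * of_bool (j = 0)) * h j)" for h k
  proof -
    have "(\<Sum>j\<le>K. (P k j - e * of_bool (j = 0)) * h j)
        = (\<Sum>j\<le>K. P k j * h j) - (\<Sum>j\<le>K. if j = 0 then e * h j else 0)"
      unfolding sum_subtractf[symmetric] by (intro sum.cong) (auto simp: algebra_simps)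
    then show ?thesis unfolding T_def by simp
  qed
  \<comment> \<open>Row 0 itself forces \<open>e \<le> 1\<close>, so the contraction factor
    \<open>q\<close> lies in [0, 1).\<close>
  have "e \<le> P 0 0" using e by auto
  also have "P 0 0 \<le> (\<Sum>j\<le>K. P 0 j)"
    by (rule member_le_sum) (auto intro: nonneg)
  also have "\<dots> = 1" using row by auto
  finally have q: "0 \<le> q" "q < 1" using e by (auto simp: q_def)
  have T_bound: "\<bar>T h k\<bar> \<le> q * B" if h: "\<And>j. j \<le> K \<Longrightarrow> \<bar>h j\<bar> \<le> B" and k: "k \<le> K" for h k B
  proof -
    have pos: "0 \<le> P k j - e * of_bool (j = 0)" if "j \<le> K" for j
      using that k nonneg e by auto
    have "\<bar>T h k\<bar> \<le> (\<Sum>j\<le>K. \<bar>(P k j - e * of_bool (j = 0)) * h j\<bar>)"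
      unfolding T_alt by (rule sum_abs)
    also have "\<dots> \<le> (\<Sum>j\<le>K. (P k j - e * of_bool (j = 0)) * B)"
      by (intro sum_mono) (simp only: abs_mult abs_of_nonneg pos atMost_iff, intro mult_left_mono h pos, auto)
    also have "\<dots> = T (\<lambda>_. B) k" unfolding T_alt ..
    also have "\<dots> = q * B"
      unfolding T_def sum_distrib_right[symmetric] row[OF k] q_def by (simp add: algebra_simps)
    finally show ?thesis .
  qed
  define g where "g n = (T ^^ n) r" for n
  have g0: "g 0 = r" and gS: "g (Suc n) = T (g n)" for n
    by (auto simp: g_def)
  define B where "B = (\<Sum>j\<le>K. \<bar>r j\<bar>)"
  have g_bound: "\<bar>g n k\<bar> \<le> q ^ n * B" if "k \<le> K" for n k
    using that
  proof (induction n arbitrary: k)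
    case 0
    then show ?case unfolding g0 B_def by (auto intro: member_le_sum)
  next
    case (Suc n)
    then show ?case using T_bound[of "g n" "q ^ n * B" k] by (auto simp: gS algebra_simps)
  qed
  have sum_g: "summable (\<lambda>n. g n k)" if "k \<le> K" for k
  proof (rule summable_comparison_test')
    show "summable (\<lambda>n. q ^ n * B)"
      using q by (intro summable_mult2 summable_geometric) auto
  qed (use g_bound that in auto)
  define s where "s k = (\<Sum>n. g n k)" for k
  have s_eq: "s k - (\<Sum>j\<le>K. P k j * s j) = r k - e * s 0" if k: "k \<le> K" for k
  proof -
    have "s k = g 0 k + (\<Sum>n. g (Suc n) k)"
      unfolding s_def using suminf_split_head[OF sum_g[OF k]] by simp
    also have "(\<Sum>n. g (Suc n) k) = (\<Sum>n. \<Sum>j\<le>K. (P k j - e * of_bool (j = 0)) * g n j)"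
      unfolding gS T_alt ..
    also have "\<dots> = (\<Sum>j\<le>K. \<Sum>n. (P k j - e * of_bool (j = 0)) * g n j)"
      by (intro suminf_sum summable_mult sum_g) auto
    also have "\<dots> = (\<Sum>j\<le>K. (P k j - e * of_bool (j = 0)) * s j)"
      unfolding s_def by (intro sum.cong refl suminf_mult sum_g) auto
    also have "\<dots> = T s k" unfolding T_alt ..
    finally show ?thesis unfolding g0 T_def by simp
  qed
  moreover have "(\<lambda>n. \<Sum>k\<le>K. a n k * r k) \<longlonglongrightarrow> e * s 0"
    if step: "\<And>n j. j \<le> K \<Longrightarrow> a (Suc n) j = (\<Sum>k\<le>K. a n k * P k j)"
      and a1: "\<And>n. (\<Sum>k\<le>K. a n k) = 1" for a
  proof -
    have m_step: "(\<Sum>j\<le>K. a (Suc n) j * h j) = e * h 0 + (\<Sum>k\<le>K. a n k * T h k)" for n h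
    proof -
      have "(\<Sum>j\<le>K. a (Suc n) j * h j) = (\<Sum>j\<le>K. \<Sum>k\<le>K. a n k * P k j * h j)"
        by (auto simp: step sum_distrib_right intro!: sum.cong)
      also have "\<dots> = (\<Sum>k\<le>K. a n k * (\<Sum>j\<le>K. P k j * h j))"
        by (subst sum.swap) (auto simp: sum_distrib_left mult.assoc intro!: sum.cong)
      also have "\<dots> = (\<Sum>k\<le>K. a n k * (e * h 0) + a n k * T h k)"
        by (auto simp: T_def algebra_simps intro!: sum.cong)
      also have "\<dots> = (\<Sum>k\<le>K. a n k) * (e * h 0) + (\<Sum>k\<le>K. a n k * T h k)"
        by (simp add: sum.distrib sum_distrib_right)
      finally show ?thesis by (simp add: a1)
    qed
    \<comment> \<open>Total mass 1 makes every step contribute \<open>e * g (m + i) 0\<close>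
      whatever the law is; the initial law survives only in a remainder that tends to 0. The offset
      \<open>m\<close> is there for the induction.\<close>
    have expand: "(\<Sum>j\<le>K. a n j * g m j) =
        (\<Sum>i<n. e * g (m + i) 0) + (\<Sum>k\<le>K. a 0 k * g (m + n) k)" for n m
    proof (induction n arbitrary: m)
      case (Suc n)
      show ?case
        by (subst m_step, subst gS[symmetric], subst Suc, subst sum.lessThan_Suc_shift) simp
    qed simp
    have "(\<lambda>n. (\<Sum>i<n. e * g i 0) + (\<Sum>k\<le>K. a 0 k * g n k)) \<longlonglongrightarrow> e * s 0 + (\<Sum>k\<le>K. a 0 k * 0)"
    proof (intro tendsto_add tendsto_sum tendsto_mult tendsto_const)
      show "(\<lambda>n. \<Sum>i<n. e * g i 0) \<longlonglongrightarrow> e * s 0"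
        unfolding s_def sum_distrib_left[symmetric]
        by (intro tendsto_mult tendsto_const summable_LIMSEQ sum_g) auto
      show "(\<lambda>n. g n k) \<longlonglongrightarrow> 0" if "k \<in> {..K}" for k
        using that by (intro summable_LIMSEQ_zero sum_g) auto
    qed
    then show ?thesis using expand[of _ 0] by (simp add: g0)
  qed
  ultimately show ?thesis by blast
qed

subsection \<open>Paths of the system\<close>

text \<open>A set of jobs instead of a count: it obeys a recursion of its own, whereas the next
  count depends on which jobs are present, and the service of each member can be averaged
  separately.\<close>

definition serving ::
  "nat \<Rightarrow> (nat \<Rightarrow> real) \<Rightarrow> (nat \<Rightarrow> real) \<Rightarrow> (nat \<Rightarrow> real) \<Rightarrow> (nat \<Rightarrow> real) \<Rightarrow> nat \<Rightarrow> nat set"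
where
  "serving K p u s v n = {m \<in> admitted K p u s v n. arrival u n < arrival u m + s m}"

lemma busy_eq_card_serving: "busy K p u s v n = card (serving K p u s v n)"
  by (simp add: busy_def in_service_def serving_def)

lemma arrival_0 [simp]: "arrival u 0 = u 0"
  by (simp add: arrival_def)

lemma arrival_Suc [simp]: "arrival u (Suc n) = arrival u n + u (Suc n)"
  by (simp add: arrival_def)

lemma arrival_mono:
  assumes "\<And>i. i \<le> n \<Longrightarrow> 0 \<le> u i" "m \<le> n"
  shows "arrival u m \<le> arrival u n"
  unfolding arrival_def using assms by (intro sum_mono2) auto

lemma arrival_cong: "(\<And>i. i \<le> n \<Longrightarrow> u i = u' i) \<Longrightarrow> arrival u n = arrival u' n"
  unfolding arrival_def by (intro sum.cong) auto

lemma admitted_subset: "admitted K p u s v n \<subseteq> {..<n}"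
  by (induction n) (auto simp: Let_def less_Suc_eq)

lemma serving_subset: "serving K p u s v n \<subseteq> {..<n}"
  using admitted_subset[of K p u s v n] by (auto simp: serving_def)

lemma finite_serving [simp]: "finite (serving K p u s v n)"
  by (rule finite_subset[OF serving_subset]) auto

lemma serving_0 [simp]: "serving K p u s v 0 = {}"
  by (simp add: serving_def)

definition admissible :: "nat \<Rightarrow> (nat \<Rightarrow> real) \<Rightarrow> nat \<Rightarrow> real \<Rightarrow> bool" where
  "admissible K p k x \<longleftrightarrow> k < K \<and> p k \<le> x"

text \<open>The jobs present just after the decision on job \<open>n\<close>, before any departure
  in the interarrival time that follows.\<close>

definition offered :: "nat \<Rightarrow> (nat \<Rightarrow> real) \<Rightarrow> nat set \<Rightarrow> nat \<Rightarrow> real \<Rightarrow> nat set" where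
  "offered K p B n x = (if admissible K p (card B) x then insert n B else B)"

text \<open>Arrival times do not decrease, so a job gone by arrival \<open>n\<close> stays gone, and
  past admissions matter only through the jobs still in service.\<close>

lemma serving_Suc:
  assumes "0 \<le> u (Suc n)"
  shows "serving K p u s v (Suc n) =
    {m \<in> offered K p (serving K p u s v n) n (v n). arrival u (Suc n) < arrival u m + s m}"
  using assms
  by (auto simp: serving_def offered_def admissible_def Let_def in_service_def)

lemma card_serving_le:
  assumes "\<And>i. i \<le> n \<Longrightarrow> 0 \<le> u i"
  shows "card (serving K p u s v n) \<le> K"
  using assms
proof (induction n)
  case (Suc n)
  let ?B = "serving K p u s v n"
  have "card (serving K p u s v (Suc n)) \<le> card (offered K p ?B n (v n))"
    using Suc.prems by (subst serving_Suc) (auto intro!: card_mono simp: offered_def)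
  also have "\<dots> \<le> K"
    using Suc serving_subset[of K p u s v n]
    by (auto simp: offered_def admissible_def card_insert_if)
  finally show ?case .
qed simp

text \<open>The indices carry the causality: the set found by job \<open>n\<close> involves
  interarrival times up to \<open>n\<close>, but services and valuations only below
  \<open>n\<close>. Hence \<open>s n\<close>, \<open>v n\<close> and \<open>u (Suc n)\<close> are
  still fresh when job \<open>n\<close> arrives.\<close>

lemma serving_cong:
  assumes "\<And>i. i \<le> n \<Longrightarrow> u i = u' i" "\<And>i. i < n \<Longrightarrow> s i = s' i" "\<And>i. i < n \<Longrightarrow> v i = v' i"
  shows "serving K p u s v n = serving K p u' s' v' n"
proof -
  have *: "admitted K p u s v m = admitted K p u' s' v' m" if "m \<le> n" for m
    using that
  proof (induction m)
    case (Suc m)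
    have "{i \<in> admitted K p u s v m. arrival u m < arrival u i + s i} =
      {i \<in> admitted K p u' s' v' m. arrival u' m < arrival u' i + s' i}"
    proof (intro Collect_cong conj_cong)
      fix i assume "i \<in> admitted K p u' s' v' m"
      then have "i < m" using admitted_subset by blast
      then show "arrival u m < arrival u i + s i \<longleftrightarrow> arrival u' m < arrival u' i + s' i"
        using Suc.prems assms arrival_cong[of m u u'] arrival_cong[of i u u'] by auto
    qed (use Suc in auto)
    then show ?case using Suc assms(3)[of m] by (auto simp: in_service_def)
  qed simp
  show ?thesis unfolding serving_def
  proof (intro Collect_cong conj_cong)
    fix i assume "i \<in> admitted K p u' s' v' n"
    then have "i < n" using admitted_subset by blast
    then show "arrival u n < arrival u i + s i \<longleftrightarrow> arrival u' n < arrival u' i + s' i"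
      using assms arrival_cong[of n u u'] arrival_cong[of i u u'] by auto
  qed (use * in auto)
qed

text \<open>Up to the arrival of job \<open>n\<close>, the service time of a job that is still in service then
  matters only through that fact.\<close>

lemma serving_cong_long_services:
  assumes u: "\<And>i. i \<le> n \<Longrightarrow> 0 \<le> u i"
    and B: "\<And>m. m \<in> B \<Longrightarrow> arrival u n < arrival u m + s m"
      "\<And>m. m \<in> B \<Longrightarrow> arrival u n < arrival u m + s' m"
    and off: "\<And>m. m \<notin> B \<Longrightarrow> s m = s' m"
  shows "serving K p u s v n = serving K p u s' v n"
proof -
  have "serving K p u s v i = serving K p u s' v i" if "i \<le> n" for i
    using that
  proof (induction i)
    case (Suc i)
    have "arrival u (Suc i) < arrival u m + s m \<longleftrightarrow> arrival u (Suc i) < arrival u m + s' m" for m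
    proof (cases "m \<in> B")
      case True
      have "arrival u (Suc i) \<le> arrival u n" using Suc.prems u by (intro arrival_mono)
      then show ?thesis using B[OF True] by linarith
    qed (simp add: off)
    then show ?case
      using Suc u[of "Suc i"] by (simp add: serving_Suc)
  qed simp
  then show ?thesis by simp
qed

text \<open>Services in \<open>B\<close> become the age at arrival \<open>n\<close> plus 1; any
  positive surplus would serve. They are then functions of the arrival times alone, which frees the
  event from the original services in \<open>B\<close>.\<close>

definition prolong :: "(nat \<Rightarrow> real) \<Rightarrow> (nat \<Rightarrow> real) \<Rightarrow> nat set \<Rightarrow> nat \<Rightarrow> nat \<Rightarrow> real" where
  "prolong u s B n m = (if m \<in> B then arrival u n - arrival u m + 1 else s m)"

lemma serving_eq_iff_prolong:
  assumes "\<And>i. i \<le> n \<Longrightarrow> 0 \<le> u i"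
  shows "serving K p u s v n = B \<longleftrightarrow>
    serving K p u (prolong u s B n) v n = B \<and> (\<forall>m\<in>B. arrival u n < arrival u m + s m)"
    (is "?L \<longleftrightarrow> ?R \<and> ?A")
proof -
  have ?A if ?L using that by (auto simp: serving_def)
  moreover have "serving K p u s v n = serving K p u (prolong u s B n) v n" if ?A
    using that assms by (intro serving_cong_long_services[where B = B]) (auto simp: prolong_def)
  ultimately show ?thesis by auto
qed

subsection \<open>Renewal sums along a path\<close>

text \<open>Unless cut off at \<open>m\<close>, the sum is the time from arrival 0 to the first
  arrival after \<open>t\<close>, and a step of size at most \<open>c\<close> overshoots
  \<open>t\<close> by at most \<open>c\<close>.\<close>

lemma renewal_sum_le:
  assumes u: "\<And>i. 0 \<le> u i" "\<And>i. u i \<le> c" and t: "0 \<le> t" "0 \<le> c"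
  shows "(\<Sum>n<m. of_bool (arrival u n \<le> t) * u (Suc n)) \<le> t + c"
proof -
  \<comment> \<open>The bound by \<open>arrival u m\<close> is what the induction needs: while this
    is at most \<open>t\<close>, one more step stays below \<open>t + c\<close>.\<close>
  have "(\<Sum>n<m. of_bool (arrival u n \<le> t) * u (Suc n)) \<le> min (t + c) (arrival u m)"
  proof (induction m)
    case 0 then show ?case using u t by simp
  next
    case (Suc m) then show ?case using u(1)[of "Suc m"] u(2)[of "Suc m"] by auto
  qed
  then show ?thesis by simp
qed

text \<open>The counterpart from below: started at \<open>u 0\<close>, the summed gaps reach beyond
  \<open>t\<close> unless \<open>m\<close> cuts them off.\<close>

lemma renewal_sum_ge:
  assumes u: "\<And>i. 0 \<le> u i"
  shows "min t (arrival u m) \<le> u 0 + (\<Sum>n<m. of_bool (arrival u n \<le> t) * u (Suc n))"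
proof (induction m)
  case (Suc m) then show ?case using u[of "Suc m"] by auto
qed simp

text \<open>A random number of summands becomes a series of indicators, which can be integrated term
  by term. Monotone arrival times make the index set an initial segment; finiteness matters because
  \<open>card\<close> of an infinite set is 0.\<close>

lemma sum_num_arrivals:
  assumes u: "\<And>i. 0 \<le> u i" and fin: "finite {n. arrival u n \<le> t}"
  shows "(\<Sum>n<num_arrivals u t. g n) = (\<Sum>n. of_bool (arrival u n \<le> t) * (g n :: real))"
proof -
  have A0: "0 \<le> arrival u n" for n unfolding arrival_def using u by (intro sum_nonneg)
  let ?N = "{n. arrival u n \<le> t}"
  have N: "?N = {..<card ?N}"
  proof (cases "?N = {}")
    case False
    have "?N = {..Max ?N}"
    proof (intro set_eqI iffI)
      fix n assume "n \<in> {..Max ?N}"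
      then have "arrival u n \<le> arrival u (Max ?N)" using u by (intro arrival_mono) auto
      then show "n \<in> ?N" using Max_in[OF fin False] by auto
    qed (use fin in auto)
    then show ?thesis by (metis card_atMost lessThan_Suc_atMost)
  qed simp
  have "num_arrivals u t = card ?N" using A0 by (simp add: num_arrivals_def)
  then have "(\<Sum>n<num_arrivals u t. g n) = (\<Sum>n\<in>?N. g n)" using N by simp
  also have "\<dots> = (\<Sum>n\<in>?N. of_bool (arrival u n \<le> t) * g n)" by simp
  also have "\<dots> = (\<Sum>n. of_bool (arrival u n \<le> t) * g n)"
    using fin by (intro suminf_finite[symmetric]) auto
  finally show ?thesis .
qed

subsection \<open>Thinning\<close>

text \<open>The binomial weight: \<open>j\<close> survivors among \<open>k\<close> jobs that survive
  independently with probability \<open>q\<close>. For \<open>j > k\<close> the coefficient is 0, so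
  the truncated \<open>k - j\<close> does no harm.\<close>

definition thin :: "real \<Rightarrow> nat \<Rightarrow> nat \<Rightarrow> real" where
  "thin q k j = real (k choose j) * q ^ j * (1 - q) ^ (k - j)"

lemma sum_thin: "k \<le> K \<Longrightarrow> (\<Sum>j\<le>K. thin q k j) = 1"
proof -
  assume "k \<le> K"
  then have "(\<Sum>j\<le>K. thin q k j) = (\<Sum>j\<le>k. thin q k j)"
    by (intro sum.mono_neutral_right) (auto simp: thin_def)
  also have "\<dots> = (q + (1 - q)) ^ k" unfolding binomial_ring thin_def ..
  finally show ?thesis by simp
qed

lemma thin_nonneg: "0 \<le> q \<Longrightarrow> q \<le> 1 \<Longrightarrow> 0 \<le> thin q k j"
  by (simp add: thin_def)

lemma thin_le_1: "0 \<le> q \<Longrightarrow> q \<le> 1 \<Longrightarrow> thin q k j \<le> 1"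
proof (cases "j \<le> k")
  assume q: "0 \<le> q" "q \<le> 1" and "j \<le> k"
  then have "thin q k j \<le> (\<Sum>j\<le>k. thin q k j)"
    by (intro member_le_sum) (auto intro: thin_nonneg)
  then show ?thesis by (simp add: sum_thin)
qed (simp add: thin_def binomial_eq_0)

lemma sum_subsets_card_eq:
  assumes "finite B"
  shows "(\<Sum>C | C \<subseteq> B \<and> card C = j. q ^ card C * (1 - q) ^ (card B - card C)) = thin q (card B) j"
proof -
  have "(\<Sum>C | C \<subseteq> B \<and> card C = j. q ^ card C * (1 - q) ^ (card B - card C))
    = (\<Sum>C | C \<subseteq> B \<and> card C = j. q ^ j * (1 - q) ^ (card B - j))"
    by (intro sum.cong) auto
  also have "\<dots> = thin q (card B) j"
    using n_subsets[OF assms, of j] by (simp add: thin_def)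
  finally show ?thesis .
qed

text \<open>Expansion over the exact set \<open>C\<close> of survivors gives products with one
  factor per job, the form in which services can be averaged one at a time.\<close>

lemma of_bool_card_Collect_eq:
  assumes "finite B"
  shows "of_bool (card {m \<in> B. Q m} = j) =
    (\<Sum>C | C \<subseteq> B \<and> card C = j. \<Prod>m\<in>B. (of_bool (m \<in> C \<longleftrightarrow> Q m) :: real))"
proof -
  have *: "(\<Prod>m\<in>B. (of_bool (m \<in> C \<longleftrightarrow> Q m) :: real)) = of_bool (C = {m \<in> B. Q m})"
    if "C \<subseteq> B" for C
  proof (cases "C = {m \<in> B. Q m}")
    case False
    then have "\<exists>m\<in>B. \<not> (m \<in> C \<longleftrightarrow> Q m)" using that by blast
    then have "(\<Prod>m\<in>B. (of_bool (m \<in> C \<longleftrightarrow> Q m) :: real)) = 0"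
      using assms by (intro prod_zero) auto
    then show ?thesis using False by simp
  qed auto
  have "(\<Sum>C | C \<subseteq> B \<and> card C = j. \<Prod>m\<in>B. (of_bool (m \<in> C \<longleftrightarrow> Q m) :: real))
    = (\<Sum>C | C \<subseteq> B \<and> card C = j. if C = {m \<in> B. Q m} then 1 else 0)"
    using * by (intro sum.cong) auto
  also have "\<dots> = of_bool (card {m \<in> B. Q m} = j)"
    using assms by (subst sum.delta) (auto simp: finite_subset)
  finally show ?thesis ..
qed

subsection \<open>The product space of the data\<close>

lemma measurable_in_service:
  assumes J: "\<And>x. J x \<subseteq> {..<n}" and [measurable]: "\<And>m. Measurable.pred N (\<lambda>x. m \<in> J x)"
    "\<And>i. (\<lambda>x. u x i) \<in> borel_measurable N" "\<And>i. (\<lambda>x. s x i) \<in> borel_measurable N"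
  shows "(\<lambda>x. in_service (u x) (s x) (J x) n) \<in> N \<rightarrow>\<^sub>M count_space UNIV"
proof -
  have "in_service (u x) (s x) (J x) n =
    (\<Sum>m<n. if m \<in> J x \<and> arrival (u x) n < arrival (u x) m + s x m then 1 else 0)" for x
    unfolding in_service_def using J[of x]
    by (subst sum.inter_filter[symmetric]) (auto intro!: arg_cong[where f = card])
  moreover have "(\<lambda>x. \<Sum>m<n. if m \<in> J x \<and> arrival (u x) n < arrival (u x) m + s x m then 1 else 0 :: nat)
      \<in> N \<rightarrow>\<^sub>M count_space UNIV"
    unfolding arrival_def by measurable
  ultimately show ?thesis by simp
qed

lemma measurable_admitted:
  assumes [measurable]: "\<And>i. (\<lambda>x. u x i) \<in> borel_measurable N"
    "\<And>i. (\<lambda>x. s x i) \<in> borel_measurable N" "\<And>i. (\<lambda>x. v x i) \<in> borel_measurable N"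
  shows "Measurable.pred N (\<lambda>x. m \<in> admitted K p (u x) (s x) (v x) n)"
proof (induction n arbitrary: m)
  case (Suc n)
  note Suc[measurable]
  have k[measurable]: "(\<lambda>x. in_service (u x) (s x) (admitted K p (u x) (s x) (v x) n) n) \<in> N \<rightarrow>\<^sub>M count_space UNIV"
    by (intro measurable_in_service admitted_subset) measurable
  have [measurable]: "(\<lambda>x. p (in_service (u x) (s x) (admitted K p (u x) (s x) (v x) n) n)) \<in> borel_measurable N"
    by (rule measurable_compose[OF k]) simp
  have "m \<in> admitted K p (u x) (s x) (v x) (Suc n) \<longleftrightarrow>
     m \<in> admitted K p (u x) (s x) (v x) n \<or> (m = n \<and>
     in_service (u x) (s x) (admitted K p (u x) (s x) (v x) n) n < K \<and>
     p (in_service (u x) (s x) (admitted K p (u x) (s x) (v x) n) n) \<le> v x n)" for x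
    by (auto simp: Let_def)
  then show ?case by simp
qed simp

lemma measurable_serving:
  assumes [measurable]: "\<And>i. (\<lambda>x. u x i) \<in> borel_measurable N"
    "\<And>i. (\<lambda>x. s x i) \<in> borel_measurable N" "\<And>i. (\<lambda>x. v x i) \<in> borel_measurable N"
  shows "Measurable.pred N (\<lambda>x. serving K p (u x) (s x) (v x) n = B)"
proof -
  note measurable_admitted[measurable]
  have "serving K p (u x) (s x) (v x) n = B \<longleftrightarrow> B \<subseteq> {..<n} \<and>
    (\<forall>m\<in>{..<n}. m \<in> B \<longleftrightarrow> m \<in> admitted K p (u x) (s x) (v x) n \<and>
      arrival (u x) n < arrival (u x) m + s x m)" for x
    using admitted_subset[of K p "u x" "s x" "v x" n] by (auto simp: serving_def)
  then show ?thesis by (simp add: arrival_def)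
qed

lemma measurable_busy:
  assumes [measurable]: "\<And>i. (\<lambda>x. u x i) \<in> borel_measurable N"
    "\<And>i. (\<lambda>x. s x i) \<in> borel_measurable N" "\<And>i. (\<lambda>x. v x i) \<in> borel_measurable N"
  shows "(\<lambda>x. busy K p (u x) (s x) (v x) n) \<in> N \<rightarrow>\<^sub>M count_space UNIV"
  unfolding busy_def by (intro measurable_in_service admitted_subset measurable_admitted assms)

text \<open>Only the three laws are given; independence will be that of a product measure. The
  service law enters through its tail, which is all that memorylessness uses.\<close>

locale iid_data =
  fixes DU DS DV :: "real measure" and lam \<mu> :: real
  assumes prob_DU: "prob_space DU" and prob_DS: "prob_space DS" and prob_DV: "prob_space DV"
    and sets_DU [measurable_cong]: "sets DU = sets borel"
    and sets_DS [measurable_cong]: "sets DS = sets borel"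
    and sets_DV [measurable_cong]: "sets DV = sets borel"
    and lam_pos: "0 < lam" and mu_pos: "0 < \<mu>"
    and DU_nonneg: "AE y in DU. 0 \<le> y"
    and DU_integrable: "integrable DU (\<lambda>y. y)"
    and DU_mean: "(\<integral>y. y \<partial>DU) = 1 / lam"
    and DS_tail: "\<And>a. 0 \<le> a \<Longrightarrow> measure DS {a<..} = exp (- \<mu> * a)"
begin

sublocale DU: prob_space DU by (rule prob_DU)
sublocale DS: prob_space DS by (rule prob_DS)
sublocale DV: prob_space DV by (rule prob_DV)

definition D :: "nat + nat + nat \<Rightarrow> real measure" where
  "D = case_sum (\<lambda>_. DU) (case_sum (\<lambda>_. DS) (\<lambda>_. DV))"

lemma D_simps [simp]: "D (Inl n) = DU" "D (Inr (Inl n)) = DS" "D (Inr (Inr n)) = DV"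
  by (auto simp: D_def)

lemma prob_D: "prob_space (D i)"
  by (auto simp: D_def prob_DU prob_DS prob_DV split: sum.split)

lemma sets_D [measurable_cong]: "sets (D i) = sets borel"
  by (auto simp: D_def sets_DU sets_DS sets_DV split: sum.split)

definition Q :: "(nat + nat + nat \<Rightarrow> real) measure" where
  "Q = PiM UNIV D"

sublocale prob_space Q
  unfolding Q_def by (intro prob_space_PiM prob_D)

lemma measurable_coord: "(\<lambda>x. x i) \<in> borel_measurable Q"
  unfolding Q_def by measurable

lemmas measurable_coords [measurable (raw)] =
  measurable_coord[of "Inl n" for n] measurable_coord[of "Inr (Inl n)" for n]
  measurable_coord[of "Inr (Inr n)" for n]

lemma measurable_upd:
  "(\<lambda>(x, y). x(i := y)) \<in> Q \<Otimes>\<^sub>M D i \<rightarrow>\<^sub>M Q"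
  unfolding Q_def case_prod_beta by (intro measurable_fun_upd[where J = UNIV]) auto

lemma space_D [simp]: "space (D i) = UNIV"
  using sets_eq_imp_space_eq[OF sets_D] by simp

lemma space_DS [simp]: "space DS = UNIV"
  using space_D[of "Inr (Inl 0)"] by simp

lemma space_Q [simp]: "space Q = UNIV"
  by (simp add: Q_def space_PiM)

lemma measurable_upd2:
  "(\<lambda>y. x(i := y)) \<in> D i \<rightarrow>\<^sub>M Q"
proof -
  have "x \<in> space (PiM UNIV D)" using space_Q by (simp add: Q_def)
  then show ?thesis unfolding Q_def by (intro measurable_fun_upd[where J = UNIV]) auto
qed

lemma AE_coord: "AE y in D i. P y \<Longrightarrow> AE x in Q. P (x i)"
  unfolding Q_def by (rule AE_PiM_component) (auto intro: prob_D)

lemma AE_U_nonneg: "AE x in Q. \<forall>n. 0 \<le> x (Inl n)"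
  unfolding AE_all_countable
proof
  show "AE x in Q. 0 \<le> x (Inl n)" for n
    by (rule AE_coord[of _ "Inl n", unfolded D_simps, OF DU_nonneg])
qed

lemma DS_pos: "AE y in DS. 0 < y"
  using DS_tail[of 0] DS.prob_eq_1[of "{0<..}"] by (simp add: sets_DS greaterThan_def)

section \<open>Independence as resampling of single coordinates\<close>

lemma integrable_bounded:
  fixes F :: "_ \<Rightarrow> real"
  assumes "F \<in> borel_measurable Q" "\<And>x. \<bar>F x\<bar> \<le> c"
  shows "integrable Q F"
  using assms by (intro integrable_const_bound[where B = c]) auto

text \<open>Overwriting a coordinate by an independent draw preserves the product measure; Fubini
  then acts as conditioning on all other coordinates.\<close>

lemma resample:
  fixes F :: "_ \<Rightarrow> real"
  assumes F: "integrable Q F"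
  shows "(\<integral>x. F x \<partial>Q) = (\<integral>x. (\<integral>y. F (x(i := y)) \<partial>D i) \<partial>Q)"
proof -
  interpret Di: prob_space "D i" by (rule prob_D)
  interpret pair_prob_space "D i" Q ..
  have meas: "(\<lambda>(y, x). x(i := y)) \<in> D i \<Otimes>\<^sub>M Q \<rightarrow>\<^sub>M Q"
    unfolding Q_def case_prod_beta by (intro measurable_fun_upd[where J = UNIV]) auto
  \<comment> \<open>The index set is already everything, so inserting \<open>i\<close> returns the
    same product.\<close>
  have *: "distr (D i \<Otimes>\<^sub>M Q) Q (\<lambda>(y, x). x(i := y)) = Q"
    using distr_pair_PiM_eq_PiM[of UNIV D i] prob_D unfolding Q_def by simp
  have [measurable]: "F \<in> borel_measurable Q" using F by auto
  have int: "integrable (D i \<Otimes>\<^sub>M Q) (\<lambda>(y, x). F (x(i := y)))"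
    using integrable_distr[OF meas, of F] F * by (simp add: case_prod_unfold)
  have "(\<integral>x. F x \<partial>Q) = (\<integral>x. F x \<partial>distr (D i \<Otimes>\<^sub>M Q) Q (\<lambda>(y, x). x(i := y)))"
    by (simp add: *)
  also have "\<dots> = (\<integral>z. (case z of (y, x) \<Rightarrow> F (x(i := y))) \<partial>(D i \<Otimes>\<^sub>M Q))"
    by (subst integral_distr[OF meas]) (auto simp: case_prod_unfold)
  also have "\<dots> = (\<integral>x. (\<integral>y. F (x(i := y)) \<partial>D i) \<partial>Q)"
    using integral_snd[OF int] by simp
  finally show ?thesis .
qed

lemma measurable_resample:
  fixes f :: "_ \<Rightarrow> real"
  assumes "f \<in> borel_measurable Q"
  shows "(\<lambda>x. \<integral>y. f (x(i := y)) \<partial>D i) \<in> borel_measurable Q"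
proof -
  interpret Di: prob_space "D i" by (rule prob_D)
  have "(\<lambda>(x, y). f (x(i := y))) \<in> borel_measurable (Q \<Otimes>\<^sub>M D i)"
    using measurable_compose[OF measurable_upd[of i] assms] by (simp add: case_prod_beta)
  then show ?thesis by (rule Di.borel_measurable_lebesgue_integral)
qed

lemma integral_mult_coord:
  fixes F :: "_ \<Rightarrow> real" and \<psi> :: "real \<Rightarrow> real"
  assumes "integrable Q (\<lambda>x. F x * \<psi> (x i))" "\<And>x y. F (x(i := y)) = F x"
  shows "(\<integral>x. F x * \<psi> (x i) \<partial>Q) = (\<integral>x. F x \<partial>Q) * (\<integral>y. \<psi> y \<partial>D i)"
  by (subst resample[OF assms(1), of i]) (simp add: assms(2))

lemma integrable_coord_iff:
  fixes \<psi> :: "real \<Rightarrow> real"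
  assumes [measurable]: "\<psi> \<in> borel_measurable borel"
  shows "integrable Q (\<lambda>x. \<psi> (x i)) \<longleftrightarrow> integrable (D i) \<psi>"
proof -
  have "distr Q (D i) (\<lambda>x. x i) = D i"
    unfolding Q_def by (rule distr_PiM_component) (auto intro: prob_D)
  moreover have "(\<lambda>x. x i) \<in> Q \<rightarrow>\<^sub>M D i" "\<psi> \<in> borel_measurable (D i)"
    by (simp_all add: measurable_coord measurable_cong_sets[OF refl sets_D] measurable_cong_sets[OF sets_D refl])
  ultimately show ?thesis
    using integrable_distr_eq[of "\<lambda>x. x i" Q "D i" \<psi>] by simp
qed

text \<open>Given all coordinates except the services of \<open>B\<close>, the factors are
  independent, since each sees at most its own service; so each may be replaced by its conditional
  mean. The bounds by 1 keep the products integrable.\<close>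

lemma resample_prod:
  fixes f :: "nat \<Rightarrow> (nat + nat + nat \<Rightarrow> real) \<Rightarrow> real"
  assumes "finite B"
    and g: "g \<in> borel_measurable Q" "\<And>x. \<bar>g x\<bar> \<le> 1"
      "\<And>m x y. m \<in> B \<Longrightarrow> g (x(Inr (Inl m) := y)) = g x"
    and f: "\<And>m. f m \<in> borel_measurable Q" "\<And>m x. \<bar>f m x\<bar> \<le> 1"
      "\<And>l m x y. l \<in> B \<Longrightarrow> m \<in> B \<Longrightarrow> l \<noteq> m \<Longrightarrow> f m (x(Inr (Inl l) := y)) = f m x"
  shows "(\<integral>x. g x * (\<Prod>m\<in>B. f m x) \<partial>Q) =
    (\<integral>x. g x * (\<Prod>m\<in>B. (\<integral>y. f m (x(Inr (Inl m) := y)) \<partial>DS)) \<partial>Q)"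
  using assms(1) g f(3)
proof (induction B arbitrary: g rule: finite_induct)
  case empty
  then show ?case by simp
next
  case (insert b B)
  define h where "h m x = (\<integral>y. f m (x(Inr (Inl m) := y)) \<partial>DS)" for m x
  note [measurable] = f(1) insert.prems(1)
  have hm[measurable]: "h m \<in> borel_measurable Q" for m
    unfolding h_def using measurable_resample[OF f(1), where i = "Inr (Inl m)"] by simp
  have hb: "\<bar>h m x\<bar> \<le> 1" for m x
  proof -
    have "\<bar>h m x\<bar> \<le> (\<integral>y. \<bar>f m (x(Inr (Inl m) := y))\<bar> \<partial>DS)"
      unfolding h_def by (rule integral_abs_bound)
    also have "\<dots> \<le> (\<integral>y. 1 \<partial>DS)"
      using f(2) measurable_compose[OF measurable_upd2[of x "Inr (Inl m)"] f(1)[of m]]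
      by (intro integral_mono DS.integrable_const_bound[where B = 1]) auto
    finally show ?thesis using DS.prob_space by simp
  qed
  have h_inv: "h m (x(Inr (Inl b) := y)) = h m x" if "m \<in> B" for m x y
  proof -
    have "b \<noteq> m" using that insert.hyps by auto
    then have "f m ((x(Inr (Inl b) := y))(Inr (Inl m) := z)) = f m (x(Inr (Inl m) := z))" for z
      using that by (subst fun_upd_twist, simp, intro insert.prems(4)) auto
    then show ?thesis unfolding h_def by simp
  qed
  have prod_bound: "\<bar>\<Prod>m\<in>B. h m x\<bar> \<le> 1" for x
    unfolding abs_prod using hb by (intro prod_le_1) auto
  \<comment> \<open>The other factors are averaged first, with \<open>f b\<close> counted into
    \<open>g\<close>. Their averages \<open>h m\<close> do not see the service of \<open>b\<close>,
    so resampling it afterwards acts on \<open>f b\<close> alone.\<close>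
  have "(\<integral>x. g x * (\<Prod>m\<in>insert b B. f m x) \<partial>Q) = (\<integral>x. (g x * f b x) * (\<Prod>m\<in>B. f m x) \<partial>Q)"
    using insert.hyps by (simp add: mult.assoc)
  also have "\<dots> = (\<integral>x. (g x * f b x) * (\<Prod>m\<in>B. h m x) \<partial>Q)"
    unfolding h_def
  proof (rule insert.IH)
    show "\<bar>g x * f b x\<bar> \<le> 1" for x
      using insert.prems(2) f(2) by (simp add: abs_mult mult_le_one)
    show "g (x(Inr (Inl m) := y)) * f b (x(Inr (Inl m) := y)) = g x * f b x" if "m \<in> B" for m x y
      using insert.hyps that
      by (intro arg_cong2[where f = "(*)"] insert.prems(3) insert.prems(4)) auto
  qed (use insert.prems in auto)
  also have "\<dots> = (\<integral>x. (\<integral>y. (g (x(Inr (Inl b) := y)) * f b (x(Inr (Inl b) := y))) *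
      (\<Prod>m\<in>B. h m (x(Inr (Inl b) := y))) \<partial>DS) \<partial>Q)"
  proof (subst resample[where i = "Inr (Inl b)"])
    show "integrable Q (\<lambda>x. g x * f b x * (\<Prod>m\<in>B. h m x))"
    proof (rule integrable_bounded[where c = 1])
      show "\<bar>g x * f b x * (\<Prod>m\<in>B. h m x)\<bar> \<le> 1" for x
        using insert.prems(2)[of x] f(2)[of b x] prod_bound[of x]
        by (simp add: abs_mult mult_le_one)
    qed measurable
  qed simp
  also have "\<dots> = (\<integral>x. (\<integral>y. (g x * (\<Prod>m\<in>B. h m x)) * f b (x(Inr (Inl b) := y)) \<partial>DS) \<partial>Q)"
  proof (intro Bochner_Integration.integral_cong refl)
    fix x y
    have "g (x(Inr (Inl b) := y)) = g x" by (rule insert.prems(3)) auto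
    moreover have "(\<Prod>m\<in>B. h m (x(Inr (Inl b) := y))) = (\<Prod>m\<in>B. h m x)"
      by (intro prod.cong h_inv refl)
    ultimately show "g (x(Inr (Inl b) := y)) * f b (x(Inr (Inl b) := y)) *
        (\<Prod>m\<in>B. h m (x(Inr (Inl b) := y))) = g x * (\<Prod>m\<in>B. h m x) * f b (x(Inr (Inl b) := y))"
      by (simp only: mult_ac)
  qed
  also have "\<dots> = (\<integral>x. g x * (\<Prod>m\<in>insert b B. h m x) \<partial>Q)"
    using insert.hyps by (simp add: h_def mult_ac)
  finally show ?case unfolding h_def .
qed

section \<open>Memoryless services and binomial thinning\<close>

lemma integral_DS_tail:
  "0 \<le> a \<Longrightarrow> (\<integral>y. of_bool (a < y) \<partial>DS) = exp (- \<mu> * a)"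
proof -
  assume "0 \<le> a"
  have "(\<integral>y. of_bool (a < y) \<partial>DS) = (\<integral>y. indicator {a<..} y \<partial>DS)"
    by (intro Bochner_Integration.integral_cong) (auto simp: indicator_def)
  also have "\<dots> = measure DS {a<..}" by simp
  finally show ?thesis using DS_tail[OF \<open>0 \<le> a\<close>] by simp
qed

text \<open>Truncating the argument at 0 keeps this in the unit interval; interarrival times are
  only almost surely nonnegative.\<close>

definition surv :: "real \<Rightarrow> real" where
  "surv y = exp (- \<mu> * max 0 y)"

lemma surv_bounds: "0 \<le> surv y" "surv y \<le> 1"
  using mu_pos by (auto simp: surv_def)

lemma measurable_surv [measurable]: "surv \<in> borel_measurable borel"
  unfolding surv_def by measurable

lemma measurable_thin [measurable]:
  "f \<in> borel_measurable N \<Longrightarrow> (\<lambda>x. thin (f x) k j) \<in> borel_measurable N"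
  unfolding thin_def by (intro borel_measurable_times borel_measurable_power) auto

abbreviation uu :: "(nat + nat + nat \<Rightarrow> real) \<Rightarrow> nat \<Rightarrow> real" where "uu x \<equiv> (\<lambda>n. x (Inl n))"
abbreviation ss :: "(nat + nat + nat \<Rightarrow> real) \<Rightarrow> nat \<Rightarrow> real" where "ss x \<equiv> (\<lambda>n. x (Inr (Inl n)))"
abbreviation vv :: "(nat + nat + nat \<Rightarrow> real) \<Rightarrow> nat \<Rightarrow> real" where "vv x \<equiv> (\<lambda>n. x (Inr (Inr n)))"

lemma measurable_arrival [measurable]: "(\<lambda>x. arrival (uu x) n) \<in> borel_measurable Q"
  unfolding arrival_def by measurable

text \<open>Memorylessness: a service exceeding the age \<open>\<alpha>\<close> lasts a further
  \<open>w\<close> with probability \<open>surv w\<close>, whatever \<open>\<alpha>\<close> is. The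
  flag \<open>c\<close> covers survival and departure at once.\<close>

lemma integral_service_gt:
  assumes "0 \<le> \<alpha>" "0 \<le> w"
  shows "(\<integral>y. of_bool (\<alpha> < y) * of_bool (c \<longleftrightarrow> \<alpha> + w < y) \<partial>DS) =
    (if c then surv w else 1 - surv w) * exp (- \<mu> * \<alpha>)"
proof -
  have int: "integrable DS (\<lambda>y. of_bool (z < y) :: real)" for z
    by (intro DS.integrable_const_bound[where B = 1]) auto
  have w: "exp (- \<mu> * (\<alpha> + w)) = surv w * exp (- \<mu> * \<alpha>)"
    using assms by (simp add: surv_def exp_add[symmetric] algebra_simps)
  show ?thesis
  proof (cases c)
    case True
    then have "(\<integral>y. (of_bool (\<alpha> < y) * of_bool (c \<longleftrightarrow> \<alpha> + w < y) :: real) \<partial>DS) = (\<integral>y. of_bool (\<alpha> + w < y) \<partial>DS)"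
      using assms by (intro Bochner_Integration.integral_cong) auto
    then show ?thesis using True assms w by (simp add: integral_DS_tail)
  next
    case False
    then have "(\<integral>y. (of_bool (\<alpha> < y) * of_bool (c \<longleftrightarrow> \<alpha> + w < y) :: real) \<partial>DS) =
      (\<integral>y. of_bool (\<alpha> < y) - of_bool (\<alpha> + w < y) \<partial>DS)"
      using assms by (intro Bochner_Integration.integral_cong) auto
    also have "\<dots> = exp (- \<mu> * \<alpha>) - exp (- \<mu> * (\<alpha> + w))"
      using assms by (subst Bochner_Integration.integral_diff[OF int int]) (simp add: integral_DS_tail)
    finally show ?thesis using False w by (simp add: algebra_simps)
  qed
qed

text \<open>The event that \<open>B\<close> is the set of jobs in service at the arrival of job \<open>n\<close> is a product of an
  event that does not involve the service times of \<open>B\<close> and of the events that these exceed the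
  ages. Hence, given the event, the residual services are independent exponential variables.\<close>

lemma thin_step:
  assumes B: "B \<subseteq> {..<n}" and B': "B' = B \<or> B' = insert n B"
    and g: "g \<in> borel_measurable Q" "\<And>x. \<bar>g x\<bar> \<le> 1"
      "\<And>m x y. g (x(Inr (Inl m) := y)) = g x"
  shows "(\<integral>x. g x * of_bool (serving K p (uu x) (ss x) (vv x) n = B) *
      of_bool (card {m \<in> B'. arrival (uu x) (Suc n) < arrival (uu x) m + ss x m} = j) \<partial>Q)
    = (\<integral>x. g x * thin (surv (x (Inl (Suc n)))) (card B') j *
      of_bool (serving K p (uu x) (ss x) (vv x) n = B) \<partial>Q)"
proof -
  note [measurable] = g(1)
  have fin: "finite B'" using B B' finite_subset[OF B] by auto
  define d where
    "d x = (of_bool (serving K p (uu x) (prolong (uu x) (ss x) B n) (vv x) n = B) :: real)" for x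
  define a where "a m x = (of_bool (arrival (uu x) n < arrival (uu x) m + ss x m) :: real)" for m x
  define b where "b C m x =
    (of_bool (m \<in> C \<longleftrightarrow> arrival (uu x) (Suc n) < arrival (uu x) m + ss x m) :: real)" for C m x
  define e where "e m x = exp (- \<mu> * \<bar>arrival (uu x) n - arrival (uu x) m\<bar>)" for m x
  define q where "q x = surv (x (Inl (Suc n)))" for x :: "nat + nat + nat \<Rightarrow> real"
  define w where "w C x = q x ^ card C * (1 - q x) ^ (card B' - card C)" for C :: "nat set" and x
  define \<C> where "\<C> = {C. C \<subseteq> B' \<and> card C = j}"
  have [simp]: "finite \<C>" using fin unfolding \<C>_def by simp

  have [measurable]: "d \<in> borel_measurable Q"
  proof -
    have "Measurable.pred Q (\<lambda>x. serving K p (uu x) (prolong (uu x) (ss x) B n) (vv x) n = B)"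
      by (rule measurable_serving) (auto simp: prolong_def)
    then show ?thesis unfolding d_def by measurable
  qed
  have [measurable]: "a m \<in> borel_measurable Q" for m
    unfolding a_def by measurable
  have [measurable]: "b C m \<in> borel_measurable Q" for C m
    unfolding b_def by measurable
  have [measurable]: "e m \<in> borel_measurable Q" for m
    unfolding e_def by measurable
  have [measurable]: "w C \<in> borel_measurable Q" for C
    unfolding w_def q_def by (intro borel_measurable_times borel_measurable_power) auto
  note measurable_serving[measurable]

  have bounds: "\<bar>d x\<bar> \<le> 1" "\<bar>a m x\<bar> \<le> 1" "\<bar>b C m x\<bar> \<le> 1" "\<bar>w C x\<bar> \<le> 1" for x m C
    using surv_bounds[of "x (Inl (Suc n))"]
    by (auto simp: d_def a_def b_def w_def q_def abs_mult power_le_one mult_le_one)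
  have bound_mult: "\<bar>y * z\<bar> \<le> 1" if "\<bar>y\<bar> \<le> 1" "\<bar>z\<bar> \<le> 1" for y z :: real
    using that by (simp add: abs_mult mult_le_one)
  have bound_prod: "\<bar>\<Prod>m\<in>B'. f m\<bar> \<le> 1" if "\<And>m. \<bar>f m\<bar> \<le> 1" for f :: "nat \<Rightarrow> real"
    unfolding abs_prod using that by (intro prod_le_1) auto

  \<comment> \<open>Two reasons: for \<open>m\<close> in \<open>B\<close> the service is overwritten
    by \<open>prolong\<close>, and for \<open>m = n\<close> it cannot influence what job
    \<open>n\<close> itself finds.\<close>
  have d_inv: "d (x(Inr (Inl m) := y)) = d x" if "m \<in> B'" for m x y
  proof -
    have "serving K p (uu x) (prolong (uu x) (ss (x(Inr (Inl m) := y))) B n) (vv x) n =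
      serving K p (uu x) (prolong (uu x) (ss x) B n) (vv x) n"
      using that B' by (intro serving_cong) (auto simp: prolong_def)
    then show ?thesis by (simp add: d_def)
  qed
  have a_inv: "a m (x(Inr (Inl l) := y)) = a m x" if "l \<noteq> m" for l m x y
    using that by (simp add: a_def)
  have b_inv: "b C m (x(Inr (Inl l) := y)) = b C m x" if "l \<noteq> m" for l m C x y
    using that by (simp add: b_def)
  have w_inv: "w C (x(Inr (Inl l) := y)) = w C x" for l C x y
    by (simp add: w_def q_def)

  have good: "AE x in Q. (\<forall>i. 0 \<le> x (Inl i)) \<and> 0 < x (Inr (Inl n))"
    using AE_U_nonneg AE_coord[of _ "Inr (Inl n)", unfolded D_simps, OF DS_pos]
    by eventually_elim auto
  have serving_eq: "of_bool (serving K p (uu x) (ss x) (vv x) n = B) = d x * (\<Prod>m\<in>B'. a m x)"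
    if x: "\<forall>i. 0 \<le> x (Inl i)" "0 < x (Inr (Inl n))" for x
  proof -
    have "(\<Prod>m\<in>B'. a m x) = (\<Prod>m\<in>B. a m x)"
    proof (cases "B' = B")
      case False
      have "n \<notin> B" using B by auto
      then show ?thesis using False B' x finite_subset[OF B] by (auto simp: a_def)
    qed auto
    also have "\<dots> = of_bool (\<forall>m\<in>B. arrival (uu x) n < arrival (uu x) m + ss x m)"
      unfolding a_def using finite_subset[OF B] by (induction B rule: infinite_finite_induct) auto
    finally show ?thesis
      using serving_eq_iff_prolong[of n "uu x" K p "ss x" "vv x" B] x by (simp add: d_def)
  qed
  have age: "0 \<le> arrival (uu x) n - arrival (uu x) m" if "\<forall>i. 0 \<le> x (Inl i)" "m \<in> B'" for x m
    using arrival_mono[of n "uu x" m] that B B' by auto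
  have hat_a: "(\<integral>y. a m (x(Inr (Inl m) := y)) \<partial>DS) = e m x"
    if "\<forall>i. 0 \<le> x (Inl i)" "m \<in> B'" for x m
    using age[OF that] integral_DS_tail[of "arrival (uu x) n - arrival (uu x) m"]
    by (simp add: a_def e_def less_diff_eq diff_less_eq add.commute)
  have hat_ab: "(\<integral>y. a m (x(Inr (Inl m) := y)) * b C m (x(Inr (Inl m) := y)) \<partial>DS) =
      (if m \<in> C then q x else 1 - q x) * e m x"
    if "\<forall>i. 0 \<le> x (Inl i)" "m \<in> B'" for x m C
  proof -
    have "(\<integral>y. a m (x(Inr (Inl m) := y)) * b C m (x(Inr (Inl m) := y)) \<partial>DS) =
      (\<integral>y. of_bool (arrival (uu x) n - arrival (uu x) m < y) *
        of_bool (m \<in> C \<longleftrightarrow> arrival (uu x) n - arrival (uu x) m + x (Inl (Suc n)) < y) \<partial>DS)"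
      by (intro Bochner_Integration.integral_cong refl)
        (auto simp: a_def b_def algebra_simps intro!: arg_cong2[where f = "(*)"])
    then show ?thesis
      using integral_service_gt[OF age[OF that], of "x (Inl (Suc n))" "m \<in> C"] that age[OF that]
      by (simp add: q_def e_def)
  qed
  have prod_q: "(\<Prod>m\<in>B'. (if m \<in> C then q x else 1 - q x) * e m x) = w C x * (\<Prod>m\<in>B'. e m x)"
    if "C \<subseteq> B'" for C x
  proof -
    have "B' \<inter> {m. m \<in> C} = C" "B' \<inter> - {m. m \<in> C} = B' - C" using that by auto
    then have "(\<Prod>m\<in>B'. if m \<in> C then q x else 1 - q x) = w C x"
      using fin that by (simp add: prod.If_cases w_def card_Diff_subset finite_subset)
    then show ?thesis by (simp add: prod.distrib)
  qed

  \<comment> \<open>Averaging turns each \<open>a m * b C m\<close> into \<open>e m\<close> times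
    \<open>q\<close> or \<open>1 - q\<close>. These weights collect into \<open>w C\<close>, which
    involves no service, and undoing the average restores the factors \<open>a m\<close>.\<close>
  have term_eq: "(\<integral>x. (g x * d x) * (\<Prod>m\<in>B'. a m x * b C m x) \<partial>Q) =
      (\<integral>x. (g x * d x * w C x) * (\<Prod>m\<in>B'. a m x) \<partial>Q)" if C: "C \<in> \<C>" for C
  proof -
    have [measurable]: "(\<lambda>x. \<integral>y. a m (x(Inr (Inl m) := y)) * b C m (x(Inr (Inl m) := y)) \<partial>DS)
        \<in> borel_measurable Q"
      "(\<lambda>x. \<integral>y. a m (x(Inr (Inl m) := y)) \<partial>DS) \<in> borel_measurable Q" for m
      using measurable_resample[of "\<lambda>x. a m x * b C m x" "Inr (Inl m)"]
        measurable_resample[of "a m" "Inr (Inl m)"] by simp_all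
    have "(\<integral>x. (g x * d x) * (\<Prod>m\<in>B'. a m x * b C m x) \<partial>Q) =
      (\<integral>x. (g x * d x) * (\<Prod>m\<in>B'. (\<integral>y. a m (x(Inr (Inl m) := y)) * b C m (x(Inr (Inl m) := y)) \<partial>DS)) \<partial>Q)"
      by (rule resample_prod; (intro fin bound_mult g bounds arg_cong2[where f = "(*)"] d_inv a_inv b_inv)?)
        simp_all
    also have "\<dots> = (\<integral>x. (g x * d x * w C x) * (\<Prod>m\<in>B'. (\<integral>y. a m (x(Inr (Inl m) := y)) \<partial>DS)) \<partial>Q)"
    proof (rule integral_cong_AE)
      show "AE x in Q. (g x * d x) * (\<Prod>m\<in>B'. (\<integral>y. a m (x(Inr (Inl m) := y)) * b C m (x(Inr (Inl m) := y)) \<partial>DS)) =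
        (g x * d x * w C x) * (\<Prod>m\<in>B'. (\<integral>y. a m (x(Inr (Inl m) := y)) \<partial>DS))"
        using good
      proof eventually_elim
        case (elim x)
        then show ?case
          using C prod_q[of C x] by (simp add: hat_a hat_ab \<C>_def)
      qed
    qed measurable
    also have "\<dots> = (\<integral>x. (g x * d x * w C x) * (\<Prod>m\<in>B'. a m x) \<partial>Q)"
      by (rule resample_prod[symmetric];
          (intro fin bound_mult g bounds arg_cong2[where f = "(*)"] d_inv w_inv a_inv)?) simp_all
    finally show ?thesis .
  qed
  have "(\<integral>x. g x * of_bool (serving K p (uu x) (ss x) (vv x) n = B) *
      of_bool (card {m \<in> B'. arrival (uu x) (Suc n) < arrival (uu x) m + ss x m} = j) \<partial>Q) =
    (\<integral>x. (\<Sum>C\<in>\<C>. (g x * d x) * (\<Prod>m\<in>B'. a m x * b C m x)) \<partial>Q)"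
  proof (rule integral_cong_AE)
    show "AE x in Q. g x * of_bool (serving K p (uu x) (ss x) (vv x) n = B) *
      of_bool (card {m \<in> B'. arrival (uu x) (Suc n) < arrival (uu x) m + ss x m} = j) =
      (\<Sum>C\<in>\<C>. (g x * d x) * (\<Prod>m\<in>B'. a m x * b C m x))"
      using good
    proof eventually_elim
      case (elim x)
      have "of_bool (card {m \<in> B'. arrival (uu x) (Suc n) < arrival (uu x) m + ss x m} = j) =
        (\<Sum>C\<in>\<C>. \<Prod>m\<in>B'. b C m x)"
        unfolding \<C>_def b_def by (rule of_bool_card_Collect_eq[OF fin])
      moreover have "of_bool (serving K p (uu x) (ss x) (vv x) n = B) = d x * (\<Prod>m\<in>B'. a m x)"
        using elim by (intro serving_eq) auto
      ultimately show ?case by (simp only: prod.distrib sum_distrib_left mult_ac)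
    qed
    have "Measurable.pred Q (\<lambda>x. card {m \<in> B'. arrival (uu x) (Suc n) < arrival (uu x) m + ss x m} = j)"
    proof -
      have "card {m \<in> B'. arrival (uu x) (Suc n) < arrival (uu x) m + ss x m} =
        (\<Sum>m\<in>B'. if arrival (uu x) (Suc n) < arrival (uu x) m + ss x m then 1 else 0)" for x
        using fin by (simp add: sum.If_cases Int_def)
      then show ?thesis by simp
    qed
    then show "(\<lambda>x. g x * of_bool (serving K p (uu x) (ss x) (vv x) n = B) *
      of_bool (card {m \<in> B'. arrival (uu x) (Suc n) < arrival (uu x) m + ss x m} = j))
      \<in> borel_measurable Q" by measurable
  qed measurable
  also have "\<dots> = (\<Sum>C\<in>\<C>. (\<integral>x. (g x * d x) * (\<Prod>m\<in>B'. a m x * b C m x) \<partial>Q))"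
    by (intro Bochner_Integration.integral_sum integrable_bounded[where c = 1]
        bound_mult bound_prod g bounds) measurable
  also have "\<dots> = (\<Sum>C\<in>\<C>. (\<integral>x. (g x * d x * w C x) * (\<Prod>m\<in>B'. a m x) \<partial>Q))"
    by (intro sum.cong term_eq refl)
  also have "\<dots> = (\<integral>x. (\<Sum>C\<in>\<C>. (g x * d x * w C x) * (\<Prod>m\<in>B'. a m x)) \<partial>Q)"
    by (intro Bochner_Integration.integral_sum[symmetric] integrable_bounded[where c = 1]
        bound_mult bound_prod g bounds) measurable
  also have "\<dots> = (\<integral>x. g x * thin (surv (x (Inl (Suc n)))) (card B') j *
      of_bool (serving K p (uu x) (ss x) (vv x) n = B) \<partial>Q)"
  proof (rule integral_cong_AE)
    show "AE x in Q. (\<Sum>C\<in>\<C>. (g x * d x * w C x) * (\<Prod>m\<in>B'. a m x)) =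
      g x * thin (surv (x (Inl (Suc n)))) (card B') j *
      of_bool (serving K p (uu x) (ss x) (vv x) n = B)"
      using good
    proof eventually_elim
      case (elim x)
      have "(\<Sum>C\<in>\<C>. w C x) = thin (surv (x (Inl (Suc n)))) (card B') j"
        unfolding \<C>_def w_def q_def using fin by (rule sum_subsets_card_eq)
      then show ?case
        using elim by (simp add: serving_eq sum_distrib_left[symmetric] sum_distrib_right[symmetric] mult_ac)
    qed
  qed measurable
  finally show ?thesis .
qed

subsection \<open>The elementary renewal theorem\<close>

definition arrival_cdf :: "real \<Rightarrow> nat \<Rightarrow> real" where
  "arrival_cdf t n = (\<integral>x. of_bool (arrival (uu x) n \<le> t) \<partial>Q)"

text \<open>The expected number of arrivals up to \<open>t\<close> as a series. Job 0 arrives at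
  \<open>u 0\<close>, so time 0 does not count as a renewal by itself.\<close>

definition renewal :: "real \<Rightarrow> real" where
  "renewal t = (\<Sum>n. arrival_cdf t n)"

lemma integrable_arrival_le: "integrable Q (\<lambda>x. of_bool (arrival (uu x) n \<le> t) :: real)"
  by (rule integrable_bounded[where c = 1]) auto

lemma arrival_cdf_nonneg: "0 \<le> arrival_cdf t n"
  unfolding arrival_cdf_def by (intro integral_nonneg_AE) auto

lemma arrival_cdf_le_1: "arrival_cdf t n \<le> 1"
proof -
  have "arrival_cdf t n \<le> (\<integral>x. 1 \<partial>Q)"
    unfolding arrival_cdf_def by (intro integral_mono integrable_arrival_le) auto
  then show ?thesis using prob_space by simp
qed

lemma arrival_upd_later: "n < m \<Longrightarrow> arrival (uu (x(Inl m := y))) n = arrival (uu x) n"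
  by (intro arrival_cong) auto

lemma integrable_U: "integrable Q (\<lambda>x. x (Inl n))"
  using integrable_coord_iff[OF measurable_ident_sets[OF refl], of "Inl n"] DU_integrable
  by (simp only: D_simps)

text \<open>The independence behind Wald's identity: whether arrival \<open>n\<close> is at most
  \<open>t\<close> does not involve the next interarrival time.\<close>

lemma integral_renewal_term:
  assumes "integrable DU \<psi>" and [measurable]: "\<psi> \<in> borel_measurable borel"
  shows "integrable Q (\<lambda>x. of_bool (arrival (uu x) n \<le> t) * \<psi> (x (Inl (Suc n))))"
    and "(\<integral>x. of_bool (arrival (uu x) n \<le> t) * \<psi> (x (Inl (Suc n))) \<partial>Q) =
      arrival_cdf t n * (\<integral>y. \<psi> y \<partial>DU)"
proof -
  have i: "integrable Q (\<lambda>x. \<psi> (x (Inl (Suc n))))"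
    using assms integrable_coord_iff[of \<psi> "Inl (Suc n)"] by simp
  show int: "integrable Q (\<lambda>x. of_bool (arrival (uu x) n \<le> t) * \<psi> (x (Inl (Suc n))))"
    by (rule Bochner_Integration.integrable_bound[OF i]) auto
  show "(\<integral>x. of_bool (arrival (uu x) n \<le> t) * \<psi> (x (Inl (Suc n))) \<partial>Q) =
      arrival_cdf t n * (\<integral>y. \<psi> y \<partial>DU)"
    unfolding arrival_cdf_def
    by (rule integral_mult_coord[OF int, unfolded D_simps])
      (rule arg_cong[where f = "\<lambda>a. of_bool (a \<le> t)", OF arrival_upd_later[OF lessI]])
qed

text \<open>Truncating the interarrival times at \<open>c\<close> only makes arrivals earlier, hence
  enlarges the indicators, and bounds the overshoot beyond \<open>t\<close>.\<close>

lemma renewal_partial_sum_le: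
  assumes c: "0 \<le> c" and t: "0 \<le> t"
  shows "(\<Sum>n<m. arrival_cdf t n) * (\<integral>y. min y c \<partial>DU) \<le> t + c"
proof -
  have int: "integrable DU (\<lambda>y. min y c)"
    using DU_integrable by (intro Bochner_Integration.integrable_min) auto
  note terms = integral_renewal_term[OF int, of _ t]
  have "(\<Sum>n<m. arrival_cdf t n) * (\<integral>y. min y c \<partial>DU) =
      (\<integral>x. (\<Sum>n<m. of_bool (arrival (uu x) n \<le> t) * min (x (Inl (Suc n))) c) \<partial>Q)"
    by (subst Bochner_Integration.integral_sum) (simp_all add: terms sum_distrib_right)
  also have "\<dots> \<le> (\<integral>x. t + c \<partial>Q)"
  proof (rule integral_mono_AE)
    show "AE x in Q. (\<Sum>n<m. of_bool (arrival (uu x) n \<le> t) * min (x (Inl (Suc n))) c) \<le> t + c"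
      using AE_U_nonneg
    proof eventually_elim
      case (elim x)
      define u where "u n = min (x (Inl n)) c" for n
      have "arrival u n \<le> arrival (uu x) n" for n
        unfolding arrival_def u_def by (intro sum_mono) auto
      then have "(\<Sum>n<m. of_bool (arrival (uu x) n \<le> t) * min (x (Inl (Suc n))) c) \<le>
          (\<Sum>n<m. of_bool (arrival u n \<le> t) * u (Suc n))"
        using elim c by (intro sum_mono) (auto simp: u_def intro: order_trans)
      also have "\<dots> \<le> t + c"
        using elim c t by (intro renewal_sum_le) (auto simp: u_def)
      finally show ?case .
    qed
  next
    show "integrable Q (\<lambda>x. \<Sum>n<m. of_bool (arrival (uu x) n \<le> t) * min (x (Inl (Suc n))) c)"
      by (intro Bochner_Integration.integrable_sum terms) measurable
  qed simp
  finally show ?thesis using prob_space by simp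
qed

lemma truncated_mean_tendsto: "(\<lambda>i. \<integral>y. min y (real i) \<partial>DU) \<longlonglongrightarrow> 1 / lam"
  unfolding DU_mean[symmetric]
proof (rule integral_dominated_convergence[where w = "\<lambda>y. \<bar>y\<bar>"])
  show "AE y in DU. (\<lambda>i. min y (real i)) \<longlonglongrightarrow> y"
  proof (intro AE_I2 tendsto_eventually)
    fix y :: real
    obtain N where "y \<le> real N" using real_arch_simple by blast
    then show "\<forall>\<^sub>F i in sequentially. min y (real i) = y"
      by (intro eventually_sequentiallyI[of N]) auto
  qed
  show "AE y in DU. norm (min y (real i)) \<le> \<bar>y\<bar>" for i
    using DU_nonneg by eventually_elim auto
  show "integrable DU (\<lambda>y. \<bar>y\<bar>)"
    using DU_integrable by (rule integrable_abs)
  show m: "(\<lambda>y. y) \<in> borel_measurable DU"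
    using DU_integrable by (rule borel_measurable_integrable)
  show "(\<lambda>y. min y (real i)) \<in> borel_measurable DU" for i
    by (intro borel_measurable_min m) simp
qed

text \<open>The mean \<open>1 / lam\<close> is positive, so some truncated mean is too, and the
  linear bound for that truncation controls all partial sums.\<close>

lemma summable_arrival_cdf: "summable (arrival_cdf t)"
proof -
  have "0 < 1 / lam" using lam_pos by simp
  from order_tendstoD(1)[OF truncated_mean_tendsto this]
  obtain i where i: "0 < (\<integral>y. min y (real i) \<partial>DU)"
    using eventually_happens'[OF sequentially_bot] by blast
  have s: "summable (arrival_cdf (max 0 t))"
  proof (rule summableI_nonneg_bounded)
    show "(\<Sum>n<m. arrival_cdf (max 0 t) n) \<le> (max 0 t + real i) / (\<integral>y. min y (real i) \<partial>DU)" for m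
      using renewal_partial_sum_le[of "real i" "max 0 t" m] i by (simp add: pos_le_divide_eq)
  qed (rule arrival_cdf_nonneg)
  show ?thesis
  proof (rule summable_comparison_test'[OF s])
    show "norm (arrival_cdf t n) \<le> arrival_cdf (max 0 t) n" for n
      using arrival_cdf_nonneg[of t n] unfolding arrival_cdf_def
      by (auto intro!: integral_mono integrable_arrival_le)
  qed
qed

lemma renewal_le:
  assumes "0 \<le> t" "0 < (\<integral>y. min y (real i) \<partial>DU)"
  shows "renewal t \<le> (t + real i) / (\<integral>y. min y (real i) \<partial>DU)"
  unfolding renewal_def
proof (rule suminf_le_const[OF summable_arrival_cdf])
  show "(\<Sum>n<m. arrival_cdf t n) \<le> (t + real i) / (\<integral>y. min y (real i) \<partial>DU)" for m
    using renewal_partial_sum_le[of "real i" t m] assms by (simp add: pos_le_divide_eq)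
qed

text \<open>Wald without truncation: the expected first arrival after \<open>t\<close> is at least
  \<open>t\<close>. The loss of 1 is the mean of \<open>u 0\<close>, multiplied by
  \<open>lam\<close>.\<close>

lemma renewal_ge:
  assumes t: "0 \<le> t"
  shows "lam * t - 1 \<le> renewal t"
proof -
  note terms = integral_renewal_term[OF DU_integrable measurable_ident_sets[OF refl], of _ t, unfolded DU_mean]
  have EU: "(\<integral>x. x (Inl 0) \<partial>Q) = 1 / lam"
    using integral_mult_coord[of "\<lambda>_. 1" "\<lambda>y. y" "Inl 0"] integrable_U[of 0] DU_mean prob_space by simp
  have *: "t * (1 - arrival_cdf t m) \<le> (1 + renewal t) / lam" for m
  proof -
    have "t * (1 - arrival_cdf t m) = (\<integral>x. t * (1 - of_bool (arrival (uu x) m \<le> t)) \<partial>Q)"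
      using prob_space integrable_arrival_le[of m t] by (simp add: arrival_cdf_def)
    also have "\<dots> \<le> (\<integral>x. x (Inl 0) + (\<Sum>n<m. of_bool (arrival (uu x) n \<le> t) * x (Inl (Suc n))) \<partial>Q)"
    proof (rule integral_mono_AE)
      show "AE x in Q. t * (1 - of_bool (arrival (uu x) m \<le> t)) \<le>
          x (Inl 0) + (\<Sum>n<m. of_bool (arrival (uu x) n \<le> t) * x (Inl (Suc n)))"
        using AE_U_nonneg
      proof eventually_elim
        case (elim x)
        have "0 \<le> arrival (uu x) m" unfolding arrival_def using elim by (intro sum_nonneg) auto
        then have "t * (1 - of_bool (arrival (uu x) m \<le> t)) \<le> min t (arrival (uu x) m)"
          using t by auto
        also have "\<dots> \<le> x (Inl 0) + (\<Sum>n<m. of_bool (arrival (uu x) n \<le> t) * x (Inl (Suc n)))"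
          using renewal_sum_ge[of "uu x" t m] elim by simp
        finally show ?case .
      qed
    next
      show "integrable Q (\<lambda>x. x (Inl 0) + (\<Sum>n<m. of_bool (arrival (uu x) n \<le> t) * x (Inl (Suc n))))"
        by (intro Bochner_Integration.integrable_add Bochner_Integration.integrable_sum terms integrable_U)
    qed (use integrable_arrival_le in simp)
    also have "\<dots> = 1 / lam + (\<Sum>n<m. arrival_cdf t n / lam)"
    proof -
      have "integrable Q (\<lambda>x. \<Sum>n<m. of_bool (arrival (uu x) n \<le> t) * x (Inl (Suc n)))"
        by (intro Bochner_Integration.integrable_sum terms)
      moreover have "(\<integral>x. (\<Sum>n<m. of_bool (arrival (uu x) n \<le> t) * x (Inl (Suc n))) \<partial>Q) =
          (\<Sum>n<m. arrival_cdf t n / lam)"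
        by (subst Bochner_Integration.integral_sum) (simp_all add: terms)
      ultimately show ?thesis
        using Bochner_Integration.integral_add[OF integrable_U[of 0]] by (simp only: EU)
    qed
    also have "\<dots> \<le> (1 + renewal t) / lam"
      unfolding renewal_def using lam_pos
      by (auto simp: sum_divide_distrib[symmetric] add_divide_distrib
          intro!: divide_right_mono sum_le_suminf summable_arrival_cdf arrival_cdf_nonneg)
    finally show ?thesis .
  qed
  have "(\<lambda>m. t * (1 - arrival_cdf t m)) \<longlonglongrightarrow> t * (1 - 0)"
    by (intro tendsto_intros summable_LIMSEQ_zero summable_arrival_cdf)
  then have "t \<le> (1 + renewal t) / lam"
    using * by (intro LIMSEQ_le_const2[where X = "\<lambda>m. t * (1 - arrival_cdf t m)"]) auto
  then show ?thesis using lam_pos by (simp add: field_simps)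
qed

lemma renewal_tendsto: "((\<lambda>t. renewal t / t) \<longlongrightarrow> lam) at_top"
proof (rule order_tendstoI)
  fix a assume "a < lam"
  have "((\<lambda>t::real. lam - 1 / t) \<longlongrightarrow> lam - 0) at_top"
    by (intro tendsto_diff tendsto_const tendsto_divide_0[OF tendsto_const]
        filterlim_at_top_imp_at_infinity filterlim_ident)
  then have "\<forall>\<^sub>F t in at_top. a < lam - 1 / t"
    by (rule order_tendstoD(1)) (simp add: \<open>a < lam\<close>)
  then show "\<forall>\<^sub>F t in at_top. a < renewal t / t"
    using eventually_gt_at_top[of 0]
  proof eventually_elim
    case (elim t)
    have "lam - 1 / t = (lam * t - 1) / t" using elim by (simp add: field_simps)
    also have "\<dots> \<le> renewal t / t" using elim renewal_ge[of t] by (intro divide_right_mono) auto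
    finally show ?case using elim by simp
  qed
next
  fix a assume a: "lam < a"
  \<comment> \<open>The truncation level is chosen so that the reciprocal of the truncated mean is
    already below \<open>a\<close>; its overshoot \<open>real i\<close> vanishes after division by
    \<open>t\<close>.\<close>
  have "1 / a < 1 / lam" using a lam_pos by (intro divide_strict_left_mono) auto
  from order_tendstoD(1)[OF truncated_mean_tendsto this]
  obtain i where i: "1 / a < (\<integral>y. min y (real i) \<partial>DU)"
    using eventually_happens'[OF sequentially_bot] by blast
  define c where "c = (\<integral>y. min y (real i) \<partial>DU)"
  have "0 < 1 / a" using a lam_pos by simp
  from this i have "0 < (\<integral>y. min y (real i) \<partial>DU)" by (rule less_trans)
  then have c: "0 < c" "1 / a < c" using i by (simp_all only: c_def)
  have "((\<lambda>t::real. real i / t) \<longlongrightarrow> 0) at_top"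
    by (rule tendsto_divide_0[OF tendsto_const])
      (intro filterlim_at_top_imp_at_infinity filterlim_ident)
  then have "((\<lambda>t::real. (1 + real i / t) / c) \<longlongrightarrow> (1 + 0) / c) at_top"
    using c by (intro tendsto_divide[OF tendsto_add] tendsto_const) auto
  moreover have "1 < c * a" using c a lam_pos by (simp only: pos_divide_less_eq)
  then have "(1 + 0) / c < a" using c by (simp add: pos_divide_less_eq mult.commute)
  ultimately have "\<forall>\<^sub>F t in at_top. (1 + real i / t) / c < a"
    by (rule order_tendstoD(2))
  then show "\<forall>\<^sub>F t in at_top. renewal t / t < a"
    using eventually_gt_at_top[of 0]
  proof eventually_elim
    case (elim t)
    have "renewal t / t \<le> ((t + real i) / c) / t"
      using elim c renewal_le[of t i] by (intro divide_right_mono) (auto simp: c_def)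
    also have "\<dots> = ((t + real i) / t) / c" by (simp only: divide_divide_eq_left mult.commute)
    also have "(t + real i) / t = 1 + real i / t" using elim by (simp add: add_divide_distrib)
    finally show ?case using elim by simp
  qed
qed

text \<open>Borel-Cantelli; it ensures that \<open>num_arrivals\<close> is a genuine count almost
  surely.\<close>

lemma AE_finite_arrivals: "AE x in Q. finite {n. arrival (uu x) n \<le> t}"
proof -
  have eq: "measure Q {x \<in> space Q. arrival (uu x) n \<le> t} = arrival_cdf t n" for n
  proof -
    have "arrival_cdf t n = (\<integral>x. indicator {x \<in> space Q. arrival (uu x) n \<le> t} x \<partial>Q)"
      unfolding arrival_cdf_def by (intro Bochner_Integration.integral_cong) (auto simp: indicator_def)
    then show ?thesis by simp
  qed
  have "AE x in Q. \<forall>\<^sub>F n in sequentially. x \<in> space Q - {x \<in> space Q. arrival (uu x) n \<le> t}"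
    using summable_arrival_cdf[of t]
    by (intro borel_cantelli_AE1) (auto simp: eq[abs_def] emeasure_eq_measure simp del: space_Q)
  then show ?thesis
  proof eventually_elim
    case (elim x)
    then obtain N where "\<And>n. N \<le> n \<Longrightarrow> \<not> arrival (uu x) n \<le> t"
      by (auto simp: eventually_sequentially)
    then have "n < N" if "arrival (uu x) n \<le> t" for n
      using that not_le by blast
    then have "{n. arrival (uu x) n \<le> t} \<subseteq> {..<N}" by blast
    then show ?case by (rule finite_subset) auto
  qed
qed

end

locale loss_system = iid_data +
  fixes K :: nat and p :: "nat \<Rightarrow> real"
begin

subsection \<open>The embedded Markov chain\<close>

abbreviation Z :: "nat \<Rightarrow> (nat + nat + nat \<Rightarrow> real) \<Rightarrow> nat" where
  "Z n x \<equiv> busy K p (uu x) (ss x) (vv x) n"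

definition survivors :: "nat \<Rightarrow> nat \<Rightarrow> real" where
  "survivors k j = (\<integral>y. thin (surv y) k j \<partial>DU)"

text \<open>The value 0 from \<open>K\<close> on encodes blocking, so the full state needs no
  separate transition rule or reward.\<close>

definition accept :: "nat \<Rightarrow> real" where
  "accept k = (if k < K then measure DV {p k..} else 0)"

definition trans_prob :: "nat \<Rightarrow> nat \<Rightarrow> real" where
  "trans_prob k j = accept k * survivors (Suc k) j + (1 - accept k) * survivors k j"

text \<open>The minorisation constant: the probability that \<open>K\<close> jobs all leave within
  one interarrival time, a lower bound for any smaller number of jobs. It does not depend on
  prices.\<close>

definition empty_prob :: real where
  "empty_prob = (\<integral>y. (1 - surv y) ^ K \<partial>DU)"

lemma measurable_Z [measurable]: "(\<lambda>x. Z n x) \<in> Q \<rightarrow>\<^sub>M count_space UNIV"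
  by (rule measurable_busy) measurable

lemma accept_bounds: "0 \<le> accept k" "accept k \<le> 1"
  by (auto simp: accept_def)

lemma integrable_thin: "integrable DU (\<lambda>y. thin (surv y) k j)"
  using surv_bounds by (intro DU.integrable_const_bound[where B = 1])
    (auto simp: thin_nonneg thin_le_1)

lemma survivors_nonneg: "0 \<le> survivors k j"
  unfolding survivors_def by (intro integral_nonneg_AE AE_I2 thin_nonneg surv_bounds)

lemma sum_survivors: "k \<le> K \<Longrightarrow> (\<Sum>j\<le>K. survivors k j) = 1"
  unfolding survivors_def
  by (subst Bochner_Integration.integral_sum[symmetric])
    (auto simp: integrable_thin sum_thin DU.prob_space)

lemma integrable_die: "integrable DU (\<lambda>y. (1 - surv y) ^ k)"
  using integrable_thin[of k 0] by (simp add: thin_def)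

lemma empty_prob_le: "k \<le> K \<Longrightarrow> empty_prob \<le> survivors k 0"
  unfolding empty_prob_def survivors_def using surv_bounds
  by (intro integral_mono integrable_die integrable_thin) (auto simp: thin_def intro!: power_decreasing)

text \<open>If it vanished, \<open>surv\<close> would be 1 almost surely, so interarrival times
  would be at most 0, against their positive mean.\<close>

lemma empty_prob_pos: "0 < empty_prob"
proof (rule ccontr)
  have nn: "AE y in DU. 0 \<le> (1 - surv y) ^ K" using surv_bounds by (intro AE_I2) auto
  assume "\<not> 0 < empty_prob"
  moreover have "0 \<le> empty_prob" unfolding empty_prob_def using nn by (rule integral_nonneg_AE)
  ultimately have "(\<integral>y. (1 - surv y) ^ K \<partial>DU) = 0" by (simp add: empty_prob_def)
  then have "AE y in DU. (1 - surv y) ^ K = 0"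
    using integral_nonneg_eq_0_iff_AE[OF integrable_die nn] by simp
  then have "AE y in DU. y \<le> 0"
    by eventually_elim (use mu_pos in \<open>auto simp: surv_def max_def split: if_splits\<close>)
  then have "(\<integral>y. y \<partial>DU) \<le> (\<integral>y. 0 \<partial>DU)"
    by (intro integral_mono_AE DU_integrable) auto
  then show False using lam_pos by (simp add: DU_mean)
qed

lemma trans_prob_nonneg: "0 \<le> trans_prob k j"
  unfolding trans_prob_def using accept_bounds survivors_nonneg by simp

lemma sum_trans_prob:
  assumes "k \<le> K"
  shows "(\<Sum>j\<le>K. trans_prob k j) = 1"
proof (cases "k < K")
  case True
  then show ?thesis
    by (simp add: trans_prob_def sum.distrib sum_distrib_left[symmetric] sum_survivors)
next
  case False
  then show ?thesis
    using assms by (simp add: trans_prob_def accept_def sum_survivors)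
qed

lemma empty_prob_le_trans_prob:
  assumes "k \<le> K"
  shows "empty_prob \<le> trans_prob k 0"
proof (cases "k < K")
  case True
  have "empty_prob = accept k * empty_prob + (1 - accept k) * empty_prob"
    by (simp add: algebra_simps)
  also have "\<dots> \<le> trans_prob k 0"
    unfolding trans_prob_def using True accept_bounds empty_prob_le
    by (intro add_mono mult_left_mono) auto
  finally show ?thesis .
next
  case False
  then show ?thesis using assms empty_prob_le[of k] by (simp add: trans_prob_def accept_def)
qed

lemma integral_admissible:
  "(\<integral>y. of_bool (admissible K p k y = c) \<partial>DV) = (if c then accept k else 1 - accept k)"
proof -
  have [simp]: "space DV = UNIV" using space_D[of "Inr (Inr 0)"] by simp
  have *: "(\<integral>y. of_bool (admissible K p k y) \<partial>DV) = accept k"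
  proof -
    have "(\<integral>y. of_bool (admissible K p k y) \<partial>DV) = (\<integral>y. (indicator (if k < K then {p k..} else {}) y :: real) \<partial>DV)"
      by (intro Bochner_Integration.integral_cong) (auto simp: admissible_def indicator_def)
    then show ?thesis by (simp add: accept_def)
  qed
  have int: "integrable DV (\<lambda>y. of_bool (admissible K p k y) :: real)"
    unfolding admissible_def by (intro DV.integrable_const_bound[where B = 1]) auto
  show ?thesis
  proof (cases c)
    case False
    then have "(\<integral>y. (of_bool (admissible K p k y = c) :: real) \<partial>DV) = (\<integral>y. 1 - of_bool (admissible K p k y) \<partial>DV)"
      by (intro Bochner_Integration.integral_cong) auto
    also have "\<dots> = 1 - accept k"
      using int * DV.prob_space by (subst Bochner_Integration.integral_diff) auto
    finally show ?thesis using False by simp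
  qed (use * in simp)
qed

lemma AE_Z_le: "AE x in Q. \<forall>n. Z n x \<le> K"
  using AE_U_nonneg by eventually_elim (auto simp: busy_eq_card_serving intro!: card_serving_le)

text \<open>The Markov property jointly with the arrival time of job \<open>n\<close>. Constant
  \<open>\<phi>\<close> gives the law of the chain; the indicator of \<open>y \<le> t\<close> gives
  the version stopped at \<open>t\<close>. The argument is arrival \<open>n\<close>, not
  \<open>Suc n\<close>, because the transition uses the next interarrival time.\<close>

lemma markov_step:
  assumes [measurable]: "\<phi> \<in> borel_measurable borel" and \<phi>: "\<And>y. \<bar>\<phi> y\<bar> \<le> (1 :: real)"
  shows "(\<integral>x. \<phi> (arrival (uu x) n) * of_bool (Z (Suc n) x = j) \<partial>Q) =
    (\<Sum>k\<le>K. (\<integral>x. \<phi> (arrival (uu x) n) * of_bool (Z n x = k) \<partial>Q) * trans_prob k j)"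
proof -
  define f where "f x = \<phi> (arrival (uu x) n)" for x :: "nat + nat + nat \<Rightarrow> real"
  define e where "e B x = (of_bool (serving K p (uu x) (ss x) (vv x) n = B) :: real)" for B x
  define adm where "adm B c x = (of_bool (admissible K p (card B) (x (Inr (Inr n))) = c) :: real)"
    for B :: "nat set" and c and x :: "nat + nat + nat \<Rightarrow> real"
  define B' where "B' B c = (if c then insert n B else B)" for B c
  define nxt where "nxt B c x = (of_bool (card {m \<in> B' B c.
    arrival (uu x) (Suc n) < arrival (uu x) m + ss x m} = j) :: real)" for B c x
  define th where "th B c y = thin (surv y) (card (B' B c)) j" for B c y
  note measurable_serving[measurable]
  have [measurable]: "f \<in> borel_measurable Q" "e B \<in> borel_measurable Q"
    "adm B c \<in> borel_measurable Q" "th B c \<in> borel_measurable borel" for B c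
    unfolding f_def e_def adm_def admissible_def th_def by measurable
  have [measurable]: "nxt B c \<in> borel_measurable Q" if "B \<subseteq> {..<n}" for B c
  proof -
    have "finite (B' B c)" using that finite_subset[OF that] by (auto simp: B'_def)
    then have "card {m \<in> B' B c. arrival (uu x) (Suc n) < arrival (uu x) m + ss x m} =
      (\<Sum>m\<in>B' B c. if arrival (uu x) (Suc n) < arrival (uu x) m + ss x m then 1 else 0)" for x
      by (simp add: sum.If_cases Int_def)
    then show ?thesis unfolding nxt_def by simp
  qed
  have bounds: "\<bar>f x\<bar> \<le> 1" "\<bar>e B x\<bar> \<le> 1" "\<bar>adm B c x\<bar> \<le> 1" "\<bar>th B c y\<bar> \<le> 1" "\<bar>nxt B c x\<bar> \<le> 1"
    for B c x y
    using \<phi> thin_nonneg[OF surv_bounds] thin_le_1[OF surv_bounds]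
    by (auto simp: f_def e_def adm_def th_def nxt_def)
  have bound_mult: "\<bar>y * z\<bar> \<le> 1" if "\<bar>y\<bar> \<le> 1" "\<bar>z\<bar> \<le> 1" for y z :: real
    using that by (simp add: abs_mult mult_le_one)
  \<comment> \<open>Integrated out in turn: the services of the jobs offered, the next interarrival
    time, and the valuation of job \<open>n\<close>.\<close>
  have one_step: "(\<integral>x. f x * adm B c x * e B x * nxt B c x \<partial>Q) =
      (\<integral>x. f x * e B x \<partial>Q) * (if c then accept (card B) else 1 - accept (card B)) *
      survivors (card (B' B c)) j" if B: "B \<subseteq> {..<n}" for B c
  proof -
    have "(\<integral>x. f x * adm B c x * e B x * nxt B c x \<partial>Q) =
      (\<integral>x. f x * adm B c x * thin (surv (x (Inl (Suc n)))) (card (B' B c)) j * e B x \<partial>Q)"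
      unfolding e_def nxt_def
    proof (rule thin_step[OF B])
      show "B' B c = B \<or> B' B c = insert n B" by (auto simp: B'_def)
      show "\<bar>f x * adm B c x\<bar> \<le> 1" for x by (intro bound_mult bounds)
      show "f (x(Inr (Inl m) := y)) * adm B c (x(Inr (Inl m) := y)) = f x * adm B c x" for m x y
        by (simp add: f_def adm_def)
    qed measurable
    also have "\<dots> = (\<integral>x. (f x * adm B c x * e B x) * th B c (x (Inl (Suc n))) \<partial>Q)"
      by (simp add: th_def mult_ac)
    also have "\<dots> = (\<integral>x. f x * adm B c x * e B x \<partial>Q) * (\<integral>y. th B c y \<partial>D (Inl (Suc n)))"
    proof (rule integral_mult_coord)
      show "f (x(Inl (Suc n) := y)) * adm B c (x(Inl (Suc n) := y)) * e B (x(Inl (Suc n) := y)) =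
        f x * adm B c x * e B x" for x y
      proof -
        have "f (x(Inl (Suc n) := y)) = f x"
          unfolding f_def by (rule arg_cong[where f = \<phi>, OF arrival_upd_later[OF lessI]])
        moreover have "serving K p (uu (x(Inl (Suc n) := y))) (ss (x(Inl (Suc n) := y))) (vv (x(Inl (Suc n) := y))) n =
            serving K p (uu x) (ss x) (vv x) n"
          by (intro serving_cong) auto
        then have "e B (x(Inl (Suc n) := y)) = e B x"
          unfolding e_def by (simp only:)
        moreover have "adm B c (x(Inl (Suc n) := y)) = adm B c x"
          by (simp add: adm_def)
        ultimately show ?thesis by (simp only:)
      qed
    qed (intro integrable_bounded[where c = 1] bound_mult bounds; measurable)
    also have "(\<integral>x. f x * adm B c x * e B x \<partial>Q) =
      (\<integral>x. (f x * e B x) * of_bool (admissible K p (card B) (x (Inr (Inr n))) = c) \<partial>Q)"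
      by (simp add: adm_def mult_ac)
    also have "\<dots> = (\<integral>x. f x * e B x \<partial>Q) *
      (\<integral>y. of_bool (admissible K p (card B) y = c) \<partial>D (Inr (Inr n)))"
    proof (rule integral_mult_coord)
      show "f (x(Inr (Inr n) := y)) * e B (x(Inr (Inr n) := y)) = f x * e B x" for x y
      proof -
        have "f (x(Inr (Inr n) := y)) = f x" by (simp add: f_def)
        moreover have "serving K p (uu (x(Inr (Inr n) := y))) (ss (x(Inr (Inr n) := y))) (vv (x(Inr (Inr n) := y))) n =
            serving K p (uu x) (ss x) (vv x) n"
          by (intro serving_cong) auto
        then have "e B (x(Inr (Inr n) := y)) = e B x"
          unfolding e_def by (simp only:)
        ultimately show ?thesis by (simp only:)
      qed
      show "integrable Q (\<lambda>x. f x * e B x * of_bool (admissible K p (card B) (x (Inr (Inr n))) = c))"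
        unfolding adm_def[symmetric]
        by (intro integrable_bounded[where c = 1] bound_mult bounds) measurable
    qed
    finally show ?thesis by (simp add: integral_admissible th_def survivors_def)
  qed
  have int: "integrable Q (\<lambda>x. f x * adm B c x * e B x * nxt B c x)" if "B \<subseteq> {..<n}" for B c
    by (intro integrable_bounded[where c = 1] bound_mult bounds) (use that in measurable)
  \<comment> \<open>On each path exactly one pair survives: \<open>B\<close> the set found by job
    \<open>n\<close>, and \<open>c\<close> the decision on it.\<close>
  have step: "AE x in Q. f x * of_bool (Z (Suc n) x = j) =
    (\<Sum>B\<in>Pow {..<n}. \<Sum>c\<in>UNIV. f x * adm B c x * e B x * nxt B c x)"
    using AE_U_nonneg
  proof eventually_elim
    case (elim x)
    define S where "S = serving K p (uu x) (ss x) (vv x) n"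
    have S: "S \<in> Pow {..<n}" using serving_subset by (auto simp: S_def)
    have "(\<Sum>B\<in>Pow {..<n}. \<Sum>c\<in>UNIV. f x * adm B c x * e B x * nxt B c x) =
      (\<Sum>B\<in>Pow {..<n}. if B = S then (\<Sum>c\<in>UNIV. f x * adm B c x * nxt B c x) else 0)"
      by (intro sum.cong) (auto simp: e_def S_def)
    also have "\<dots> = (\<Sum>c\<in>UNIV. f x * adm S c x * nxt S c x)"
      using S by (subst sum.delta) auto
    also have "\<dots> = f x * nxt S (admissible K p (card S) (x (Inr (Inr n)))) x"
      by (simp add: UNIV_bool adm_def)
    also have "\<dots> = f x * of_bool (Z (Suc n) x = j)"
      using elim by (simp add: nxt_def busy_eq_card_serving serving_Suc offered_def B'_def S_def)
    finally show ?case ..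
  qed
  \<comment> \<open>Sets of more than \<open>K\<close> jobs are null, so the sum over sets can be
    regrouped into states up to \<open>K\<close>.\<close>
  have zero: "(\<integral>x. f x * e B x \<partial>Q) = 0" if "K < card B" for B
  proof -
    have "AE x in Q. f x * e B x = 0"
      using AE_Z_le
    proof eventually_elim
      case (elim x)
      then have "card (serving K p (uu x) (ss x) (vv x) n) \<le> K" by (simp add: busy_eq_card_serving)
      then show ?case using that by (auto simp: e_def)
    qed
    then show ?thesis by (rule integral_eq_zero_AE)
  qed
  have level: "(\<integral>x. f x * of_bool (Z n x = k) \<partial>Q) =
    (\<Sum>B\<in>Pow {..<n}. of_bool (card B = k) * (\<integral>x. f x * e B x \<partial>Q))" for k
  proof -
    have "f x * of_bool (Z n x = k) = (\<Sum>B\<in>Pow {..<n}. of_bool (card B = k) * (f x * e B x))" for x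
    proof -
      define S where "S = serving K p (uu x) (ss x) (vv x) n"
      have "(\<Sum>B\<in>Pow {..<n}. of_bool (card B = k) * (f x * e B x)) =
        (\<Sum>B\<in>Pow {..<n}. if B = S then of_bool (card B = k) * f x else 0)"
        by (intro sum.cong) (auto simp: e_def S_def)
      also have "\<dots> = of_bool (card S = k) * f x"
        using serving_subset by (subst sum.delta) (auto simp: S_def)
      finally show ?thesis by (simp add: busy_eq_card_serving S_def)
    qed
    then show ?thesis
      by (simp add: Bochner_Integration.integral_sum integrable_bounded[where c = 1] bound_mult bounds)
  qed
  have "(\<integral>x. f x * of_bool (Z (Suc n) x = j) \<partial>Q) =
    (\<integral>x. (\<Sum>B\<in>Pow {..<n}. \<Sum>c\<in>UNIV. f x * adm B c x * e B x * nxt B c x) \<partial>Q)"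
    using step by (intro integral_cong_AE) auto
  also have "\<dots> = (\<Sum>B\<in>Pow {..<n}. (\<integral>x. (\<Sum>c\<in>UNIV. f x * adm B c x * e B x * nxt B c x) \<partial>Q))"
    by (intro Bochner_Integration.integral_sum Bochner_Integration.integrable_sum int) auto
  also have "\<dots> = (\<Sum>B\<in>Pow {..<n}. \<Sum>c\<in>UNIV. (\<integral>x. f x * adm B c x * e B x * nxt B c x \<partial>Q))"
    by (intro sum.cong refl Bochner_Integration.integral_sum int) auto
  also have "\<dots> = (\<Sum>B\<in>Pow {..<n}. (\<integral>x. f x * e B x \<partial>Q) * trans_prob (card B) j)"
  proof (intro sum.cong refl)
    fix B assume B: "B \<in> Pow {..<n}"
    then have "finite B" "n \<notin> B" by (auto dest: finite_subset)
    then have "card (B' B True) = Suc (card B)" "card (B' B False) = card B" by (auto simp: B'_def)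
    then have "(\<Sum>c\<in>UNIV. (\<integral>x. f x * adm B c x * e B x * nxt B c x \<partial>Q)) =
      (\<integral>x. f x * e B x \<partial>Q) * (1 - accept (card B)) * survivors (card B) j +
      (\<integral>x. f x * e B x \<partial>Q) * accept (card B) * survivors (Suc (card B)) j"
      using B by (simp add: one_step UNIV_bool)
    also have "\<dots> = (\<integral>x. f x * e B x \<partial>Q) * trans_prob (card B) j"
      by (simp add: trans_prob_def distrib_left)
    finally show "(\<Sum>c\<in>UNIV. (\<integral>x. f x * adm B c x * e B x * nxt B c x \<partial>Q)) =
      (\<integral>x. f x * e B x \<partial>Q) * trans_prob (card B) j" .
  qed
  also have "\<dots> = (\<Sum>B\<in>Pow {..<n}. \<Sum>k\<le>K. of_bool (card B = k) * (\<integral>x. f x * e B x \<partial>Q) * trans_prob k j)"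
  proof (intro sum.cong refl)
    fix B
    have "(\<Sum>k\<le>K. of_bool (card B = k) * (\<integral>x. f x * e B x \<partial>Q) * trans_prob k j) =
      (\<Sum>k\<le>K. if k = card B then (\<integral>x. f x * e B x \<partial>Q) * trans_prob k j else 0)"
      by (intro sum.cong) auto
    also have "\<dots> = (\<integral>x. f x * e B x \<partial>Q) * trans_prob (card B) j"
      using zero[of B] by (subst sum.delta) auto
    finally show "(\<integral>x. f x * e B x \<partial>Q) * trans_prob (card B) j =
      (\<Sum>k\<le>K. of_bool (card B = k) * (\<integral>x. f x * e B x \<partial>Q) * trans_prob k j)" ..
  qed
  also have "\<dots> = (\<Sum>k\<le>K. (\<integral>x. f x * of_bool (Z n x = k) \<partial>Q) * trans_prob k j)"
    unfolding level sum_distrib_right by (rule sum.swap)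
  finally show ?thesis unfolding f_def .
qed

subsection \<open>The limits\<close>

definition busy_prob :: "nat \<Rightarrow> nat \<Rightarrow> real" where
  "busy_prob n k = measure Q {x \<in> space Q. Z n x = k}"

definition early :: "real \<Rightarrow> nat \<Rightarrow> nat \<Rightarrow> real" where
  "early t n k = (\<integral>x. of_bool (arrival (uu x) n \<le> t) * of_bool (Z n x = k) \<partial>Q)"

definition reward :: "nat \<Rightarrow> real" where
  "reward k = p k * accept k"

lemma busy_prob_eq: "busy_prob n k = (\<integral>x. of_bool (Z n x = k) \<partial>Q)"
proof -
  have "(\<integral>x. of_bool (Z n x = k) \<partial>Q) = (\<integral>x. (indicator {x \<in> space Q. Z n x = k} x :: real) \<partial>Q)"
    by (intro Bochner_Integration.integral_cong) (auto simp: indicator_def)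
  then show ?thesis by (simp add: busy_prob_def)
qed

lemma busy_prob_nonneg: "0 \<le> busy_prob n k"
  by (simp add: busy_prob_def)

lemma sum_of_bool_Z: "AE x in Q. (\<Sum>k\<le>K. of_bool (Z n x = k) :: real) = 1"
  using AE_Z_le
proof eventually_elim
  case (elim x)
  have "(\<Sum>k\<le>K. of_bool (Z n x = k) :: real) = (\<Sum>k\<le>K. if k = Z n x then 1 else 0)"
    by (intro sum.cong) auto
  then show ?case using elim by simp
qed

lemma sum_busy_prob: "(\<Sum>k\<le>K. busy_prob n k) = 1"
proof -
  have "(\<Sum>k\<le>K. busy_prob n k) = (\<integral>x. (\<Sum>k\<le>K. of_bool (Z n x = k)) \<partial>Q)"
    unfolding busy_prob_eq
    by (intro Bochner_Integration.integral_sum[symmetric] integrable_bounded[where c = 1]) auto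
  also have "\<dots> = (\<integral>x. 1 \<partial>Q)"
    using sum_of_bool_Z by (intro integral_cong_AE) auto
  finally show ?thesis using prob_space by simp
qed

lemma busy_prob_Suc: "busy_prob (Suc n) j = (\<Sum>k\<le>K. busy_prob n k * trans_prob k j)"
  using markov_step[of "\<lambda>_. 1" n j] by (simp add: busy_prob_eq)

text \<open>After one transition state 0 has mass at least \<open>empty_prob\<close>, and
  \<open>1 \<le> K\<close> makes it different from the full state. This keeps the blocking
  probability away from 1.\<close>

lemma busy_prob_full:
  assumes "1 \<le> K"
  shows "busy_prob (Suc n) K \<le> 1 - empty_prob"
proof -
  have "empty_prob = (\<Sum>k\<le>K. busy_prob n k * empty_prob)"
    by (simp add: sum_distrib_right[symmetric] sum_busy_prob)
  also have "\<dots> \<le> busy_prob (Suc n) 0"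
    unfolding busy_prob_Suc
    by (intro sum_mono mult_left_mono empty_prob_le_trans_prob busy_prob_nonneg) auto
  also have "\<dots> + busy_prob (Suc n) K = (\<Sum>k\<in>{0, K}. busy_prob (Suc n) k)"
    using assms by simp
  then have "busy_prob (Suc n) 0 \<le> (\<Sum>k\<in>{0, K}. busy_prob (Suc n) k) - busy_prob (Suc n) K" by simp
  also have "(\<Sum>k\<in>{0, K}. busy_prob (Suc n) k) \<le> (\<Sum>k\<le>K. busy_prob (Suc n) k)"
    by (intro sum_mono2) (auto intro: busy_prob_nonneg)
  finally show ?thesis using sum_busy_prob[of "Suc n"] by linarith
qed

lemma integrable_early:
  "integrable Q (\<lambda>x. of_bool (arrival (uu x) n \<le> t) * of_bool (Z m x = k) :: real)"
  by (rule integrable_bounded[where c = 1]) auto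

lemma sum_early: "(\<Sum>k\<le>K. early t n k) = arrival_cdf t n"
proof -
  have "(\<Sum>k\<le>K. early t n k) =
    (\<integral>x. (\<Sum>k\<le>K. of_bool (arrival (uu x) n \<le> t) * of_bool (Z n x = k)) \<partial>Q)"
    unfolding early_def
    by (intro Bochner_Integration.integral_sum[symmetric] integrable_early)
  also have "\<dots> = (\<integral>x. of_bool (arrival (uu x) n \<le> t) \<partial>Q)"
  proof (rule integral_cong_AE)
    show "AE x in Q. (\<Sum>k\<le>K. of_bool (arrival (uu x) n \<le> t) * of_bool (Z n x = k)) =
      (of_bool (arrival (uu x) n \<le> t) :: real)"
      using sum_of_bool_Z[of n] by eventually_elim (simp only: sum_distrib_left[symmetric] mult_1_right)
  qed measurable
  finally show ?thesis by (simp add: arrival_cdf_def)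
qed

lemma early_nonneg: "0 \<le> early t n k"
  unfolding early_def by (intro integral_nonneg_AE) auto

lemma early_le: "early t n k \<le> arrival_cdf t n"
  unfolding early_def arrival_cdf_def
  by (intro integral_mono integrable_early integrable_arrival_le) auto

text \<open>Optional stopping at the first arrival after \<open>t\<close>: summed up to it, the Poisson equation
  telescopes, which leaves an error that is bounded in \<open>t\<close> and \<open>m\<close>.\<close>

lemma sum_early_reward:
  assumes s: "\<And>k. k \<le> K \<Longrightarrow> s k - (\<Sum>j\<le>K. trans_prob k j * s j) = r k - c"
  shows "\<bar>(\<Sum>n<m. \<Sum>k\<le>K. early t n k * r k) - c * (\<Sum>n<m. arrival_cdf t n)\<bar> \<le> 3 * (\<Sum>k\<le>K. \<bar>s k\<bar>)"
proof -
  \<comment> \<open>The indicator still refers to arrival \<open>n\<close> while the state is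
    already that of job \<open>Suc n\<close>: the stopped law pushed one step forward.\<close>
  define late where
    "late n k = (\<integral>x. (of_bool (arrival (uu x) n \<le> t) * of_bool (Z (Suc n) x = k) :: real) \<partial>Q)" for n k
  define a where "a n = (\<Sum>k\<le>K. early t n k * s k)" for n
  define b where "b n = (\<Sum>k\<le>K. late n k * s k)" for n
  define C where "C = (\<Sum>k\<le>K. \<bar>s k\<bar>)"
  have late: "late n j = (\<Sum>k\<le>K. early t n k * trans_prob k j)" for n j
    using markov_step[of "\<lambda>y. of_bool (y \<le> t)" n j] by (simp add: late_def early_def)
  have ab: "(\<Sum>k\<le>K. early t n k * r k) - c * arrival_cdf t n = a n - b n" for n
  proof -
    have "b n = (\<Sum>k\<le>K. early t n k * (\<Sum>j\<le>K. trans_prob k j * s j))"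
      unfolding b_def late sum_distrib_right sum_distrib_left
      by (subst sum.swap) (simp add: mult.assoc)
    then have "a n - b n = (\<Sum>k\<le>K. early t n k * (s k - (\<Sum>j\<le>K. trans_prob k j * s j)))"
      by (simp add: a_def right_diff_distrib sum_subtractf)
    also have "\<dots> = (\<Sum>k\<le>K. early t n k * (r k - c))"
      by (intro sum.cong) (auto simp: s)
    also have "\<dots> = (\<Sum>k\<le>K. early t n k * r k) - (\<Sum>k\<le>K. early t n k) * c"
      by (simp add: right_diff_distrib sum_subtractf sum_distrib_right)
    finally show ?thesis by (simp add: sum_early mult.commute)
  qed
  have a_le: "\<bar>a n\<bar> \<le> C" for n
    unfolding a_def C_def
  proof (rule order_trans[OF sum_abs sum_mono])
    fix k
    show "\<bar>early t n k * s k\<bar> \<le> \<bar>s k\<bar>"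
      using early_nonneg[of t n k] early_le[of t n k] arrival_cdf_le_1[of t n]
      by (simp add: abs_mult mult_left_le_one_le)
  qed
  \<comment> \<open>The two differ only where \<open>t\<close> separates arrival \<open>n\<close>
    from arrival \<open>Suc n\<close>; the probabilities of these events telescope.\<close>
  have gap: "\<bar>a (Suc n) - b n\<bar> \<le> C * (arrival_cdf t n - arrival_cdf t (Suc n))" for n
  proof -
    have "\<bar>early t (Suc n) k - late n k\<bar> \<le> arrival_cdf t n - arrival_cdf t (Suc n)" for k
    proof -
      have "\<bar>early t (Suc n) k - late n k\<bar> =
        \<bar>\<integral>x. of_bool (arrival (uu x) (Suc n) \<le> t) * of_bool (Z (Suc n) x = k) -
          of_bool (arrival (uu x) n \<le> t) * of_bool (Z (Suc n) x = k) \<partial>Q\<bar>"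
        unfolding early_def late_def
        by (subst Bochner_Integration.integral_diff[OF integrable_early integrable_early]) simp
      also have "\<dots> \<le> (\<integral>x. \<bar>of_bool (arrival (uu x) (Suc n) \<le> t) * of_bool (Z (Suc n) x = k) -
          of_bool (arrival (uu x) n \<le> t) * of_bool (Z (Suc n) x = k)\<bar> \<partial>Q)"
        by (rule integral_abs_bound)
      also have "\<dots> \<le> (\<integral>x. of_bool (arrival (uu x) n \<le> t) - of_bool (arrival (uu x) (Suc n) \<le> t) \<partial>Q)"
      proof (rule integral_mono_AE)
        show "AE x in Q. \<bar>of_bool (arrival (uu x) (Suc n) \<le> t) * of_bool (Z (Suc n) x = k) -
          of_bool (arrival (uu x) n \<le> t) * of_bool (Z (Suc n) x = k)\<bar> \<le>
          (of_bool (arrival (uu x) n \<le> t) - of_bool (arrival (uu x) (Suc n) \<le> t) :: real)"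
          using AE_U_nonneg
        proof eventually_elim
          case (elim x)
          then have "arrival (uu x) n \<le> arrival (uu x) (Suc n)" by (intro arrival_mono) auto
          then show ?case by (auto simp del: arrival_Suc)
        qed
      qed (intro integrable_abs Bochner_Integration.integrable_diff integrable_early integrable_arrival_le)+
      also have "\<dots> = arrival_cdf t n - arrival_cdf t (Suc n)"
        unfolding arrival_cdf_def
        by (rule Bochner_Integration.integral_diff[OF integrable_arrival_le integrable_arrival_le])
      finally show ?thesis .
    qed
    note * = this
    have "\<bar>a (Suc n) - b n\<bar> = \<bar>\<Sum>k\<le>K. (early t (Suc n) k - late n k) * s k\<bar>"
      by (simp add: a_def b_def left_diff_distrib sum_subtractf)
    also have "\<dots> \<le> (\<Sum>k\<le>K. (arrival_cdf t n - arrival_cdf t (Suc n)) * \<bar>s k\<bar>)"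
      by (rule order_trans[OF sum_abs sum_mono]) (simp add: abs_mult mult_right_mono *)
    finally show ?thesis by (simp add: C_def sum_distrib_right mult.commute)
  qed
  have C: "0 \<le> C" unfolding C_def by (intro sum_nonneg) auto
  have "(\<Sum>n<m. \<Sum>k\<le>K. early t n k * r k) - c * (\<Sum>n<m. arrival_cdf t n) = (\<Sum>n<m. a n - b n)"
    unfolding sum_distrib_left sum_subtractf[symmetric] ab ..
  also have "\<dots> = a 0 - a m + (\<Sum>n<m. a (Suc n) - b n)"
    by (induction m) auto
  \<comment> \<open>The factor 3: the two ends of the telescope and the accumulated gaps contribute
    at most \<open>C\<close> each.\<close>
  also have "\<bar>\<dots>\<bar> \<le> \<bar>a 0\<bar> + \<bar>a m\<bar> + \<bar>\<Sum>n<m. a (Suc n) - b n\<bar>"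
    by linarith
  also have "\<bar>\<Sum>n<m. a (Suc n) - b n\<bar> \<le> (\<Sum>n<m. C * (arrival_cdf t n - arrival_cdf t (Suc n)))"
    by (rule order_trans[OF sum_abs sum_mono]) (rule gap)
  also have "\<dots> = C * (arrival_cdf t 0 - arrival_cdf t m)"
    unfolding sum_distrib_left[symmetric] by (simp add: sum_lessThan_telescope')
  also have "\<dots> \<le> C * 1"
    using C arrival_cdf_nonneg[of t m] arrival_cdf_le_1[of t 0] by (intro mult_left_mono) auto
  finally show ?thesis using a_le[of 0] a_le[of m] by (simp add: C_def)
qed

section \<open>Expected revenue and its growth rate\<close>

lemma measurable_revenue: "(\<lambda>x. revenue K p (uu x) (ss x) (vv x) t) \<in> borel_measurable Q"
proof -
  define g where "g n x = (\<Sum>k<K. p k * of_bool (p k \<le> x (Inr (Inr n))) * of_bool (Z n x = k))"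
    for n and x :: "nat + nat + nat \<Rightarrow> real"
  have [measurable]: "g n \<in> borel_measurable Q" for n
    unfolding g_def by measurable
  have [measurable]: "(\<lambda>x. num_arrivals (uu x) t) \<in> Q \<rightarrow>\<^sub>M count_space UNIV"
    unfolding num_arrivals_def
    by (rule measurable_card) (unfold mem_Collect_eq atLeastAtMost_iff, measurable)
  have "(\<lambda>x. \<Sum>n<num_arrivals (uu x) t. g n x) \<in> borel_measurable Q"
    by (rule measurable_compose_countable[where f = "\<lambda>N x. \<Sum>n<N. g n x"]) measurable
  then show ?thesis unfolding revenue_def g_def .
qed

text \<open>One payment is bounded by \<open>C\<close>, so summability of \<open>arrival_cdf\<close>
  justifies integrating term by term. The valuation of job \<open>n\<close> is independent of its
  arrival time and of what it finds, which yields the factor \<open>accept\<close>.\<close>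

lemma integral_revenue:
  "(\<lambda>n. \<Sum>k\<le>K. early t n k * reward k) sums
    (\<integral>x. revenue K p (uu x) (ss x) (vv x) t \<partial>Q)"
proof -
  define g where "g n x = (\<Sum>k<K. p k * of_bool (p k \<le> x (Inr (Inr n))) * of_bool (Z n x = k))"
    for n and x :: "nat + nat + nat \<Rightarrow> real"
  define h where "h n x = of_bool (arrival (uu x) n \<le> t) * g n x" for n x
  define C where "C = (\<Sum>k<K. \<bar>p k\<bar>)"
  have [measurable]: "g n \<in> borel_measurable Q" for n
    unfolding g_def by measurable
  have [measurable]: "h n \<in> borel_measurable Q" for n
    unfolding h_def by measurable
  have g_le: "\<bar>g n x\<bar> \<le> C" for n x
    unfolding g_def C_def by (rule order_trans[OF sum_abs sum_mono]) (auto simp: abs_mult)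
  have C: "0 \<le> C" unfolding C_def by (intro sum_nonneg) auto
  have h_le: "\<bar>h n x\<bar> \<le> C * of_bool (arrival (uu x) n \<le> t)" for n x
    using g_le[of n x] by (auto simp: h_def)
  have h_int: "integrable Q (h n)" for n
    using g_le C by (intro integrable_bounded[where c = C]) (auto simp: h_def)
  have fin: "AE x in Q. (\<forall>n. 0 \<le> x (Inl n)) \<and> finite {n. arrival (uu x) n \<le> t}"
    using AE_U_nonneg AE_finite_arrivals[of t] by eventually_elim auto
  have "(\<lambda>n. \<integral>x. h n x \<partial>Q) sums (\<integral>x. (\<Sum>n. h n x) \<partial>Q)"
  proof (rule sums_integral[OF h_int])
    show "AE x in Q. summable (\<lambda>n. norm (h n x))"
      using fin
    proof eventually_elim
      case (elim x)
      then show ?case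
        by (intro summable_finite[where N = "{n. arrival (uu x) n \<le> t}"]) (auto simp: h_def)
    qed
    show "summable (\<lambda>n. \<integral>x. norm (h n x) \<partial>Q)"
    proof (rule summable_comparison_test')
      show "summable (\<lambda>n. C * arrival_cdf t n)" by (intro summable_mult summable_arrival_cdf)
      show "norm (\<integral>x. norm (h n x) \<partial>Q) \<le> C * arrival_cdf t n" for n
      proof -
        have "(\<integral>x. norm (h n x) \<partial>Q) \<le> (\<integral>x. C * of_bool (arrival (uu x) n \<le> t) \<partial>Q)"
          using h_le h_int by (intro integral_mono integrable_norm integrable_mult_right integrable_arrival_le) auto
        then show ?thesis by (simp add: arrival_cdf_def)
      qed
    qed
  qed
  moreover have "(\<integral>x. (\<Sum>n. h n x) \<partial>Q) = (\<integral>x. revenue K p (uu x) (ss x) (vv x) t \<partial>Q)"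
  proof (rule integral_cong_AE)
    show "AE x in Q. (\<Sum>n. h n x) = revenue K p (uu x) (ss x) (vv x) t"
      using fin
    proof eventually_elim
      case (elim x)
      then show ?case
        unfolding h_def revenue_def g_def by (subst sum_num_arrivals) auto
    qed
    show "(\<lambda>x. \<Sum>n. h n x) \<in> borel_measurable Q" by measurable
    show "(\<lambda>x. revenue K p (uu x) (ss x) (vv x) t) \<in> borel_measurable Q"
      by (rule measurable_revenue)
  qed
  moreover have "(\<integral>x. h n x \<partial>Q) = (\<Sum>k\<le>K. early t n k * reward k)" for n
  proof -
    have "(\<integral>x. h n x \<partial>Q) = (\<integral>x. (\<Sum>k<K. p k * ((of_bool (arrival (uu x) n \<le> t) * of_bool (Z n x = k)) *
        of_bool (admissible K p k (x (Inr (Inr n)))))) \<partial>Q)"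
      unfolding h_def g_def sum_distrib_left
      by (intro Bochner_Integration.integral_cong sum.cong refl) (auto simp: admissible_def)
    also have "\<dots> = (\<Sum>k<K. p k * (early t n k * accept k))"
    proof -
      have int: "integrable Q (\<lambda>x. (of_bool (arrival (uu x) n \<le> t) * of_bool (Z n x = k)) *
        of_bool (admissible K p k (x (Inr (Inr n)))) :: real)" for k
        unfolding admissible_def by (intro integrable_bounded[where c = 1]) auto
      have "(\<integral>x. (of_bool (arrival (uu x) n \<le> t) * of_bool (Z n x = k)) *
        of_bool (admissible K p k (x (Inr (Inr n)))) \<partial>Q) =
        early t n k * (\<integral>y. of_bool (admissible K p k y) \<partial>D (Inr (Inr n)))" for k
        unfolding early_def
      proof (rule integral_mult_coord[OF int])
        fix x :: "nat + nat + nat \<Rightarrow> real" and y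
        have "Z n (x(Inr (Inr n) := y)) = Z n x"
          unfolding busy_eq_card_serving
          by (intro arg_cong[where f = card] serving_cong) auto
        moreover have "arrival (uu (x(Inr (Inr n) := y))) n = arrival (uu x) n" by simp
        ultimately show "of_bool (arrival (uu (x(Inr (Inr n) := y))) n \<le> t) *
            of_bool (Z n (x(Inr (Inr n) := y)) = k) =
          (of_bool (arrival (uu x) n \<le> t) * of_bool (Z n x = k) :: real)" by (simp only:)
      qed
      moreover have "(\<integral>y. of_bool (admissible K p k y) \<partial>D (Inr (Inr n))) = accept k" for k
        using integral_admissible[of k True] by simp
      ultimately show ?thesis
        using int by (subst Bochner_Integration.integral_sum) (auto simp: integrable_mult_right)
    qed
    also have "\<dots> = (\<Sum>k\<le>K. early t n k * reward k)"
      by (simp add: lessThan_Suc_atMost[symmetric] reward_def accept_def mult_ac)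
    finally show ?thesis .
  qed
  ultimately show ?thesis by simp
qed

text \<open>The constant of the Poisson equation is the common link: it is the limiting mean reward
  per job, and expected revenue differs from \<open>c * renewal t\<close> by a bounded
  amount.\<close>

theorem revenue_rate_limit:
  obtains c where "(\<lambda>n. \<Sum>k\<le>K. busy_prob n k * reward k) \<longlonglongrightarrow> c"
    and "((\<lambda>t. (\<integral>x. revenue K p (uu x) (ss x) (vv x) t \<partial>Q) / t) \<longlongrightarrow> lam * c) at_top"
proof -
  obtain s c where s: "\<forall>k\<le>K. s k - (\<Sum>j\<le>K. trans_prob k j * s j) = reward k - c"
    and lim: "\<forall>a. (\<forall>n. \<forall>j\<le>K. a (Suc n) j = (\<Sum>k\<le>K. a n k * trans_prob k j)) \<longrightarrow>
      (\<forall>n. (\<Sum>k\<le>K. a n k) = 1) \<longrightarrow> (\<lambda>n. \<Sum>k\<le>K. a n k * reward k) \<longlonglongrightarrow> c"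
    using doeblin_poisson_equation[of K trans_prob empty_prob reward,
        OF trans_prob_nonneg sum_trans_prob empty_prob_pos empty_prob_le_trans_prob] by blast
  define C where "C = 3 * (\<Sum>k\<le>K. \<bar>s k\<bar>)"
  define ER where "ER t = (\<integral>x. revenue K p (uu x) (ss x) (vv x) t \<partial>Q)" for t
  have bound: "\<bar>ER t - c * renewal t\<bar> \<le> C" for t
  proof (rule LIMSEQ_le_const2)
    show "(\<lambda>m. \<bar>(\<Sum>n<m. \<Sum>k\<le>K. early t n k * reward k) - c * (\<Sum>n<m. arrival_cdf t n)\<bar>)
        \<longlonglongrightarrow> \<bar>ER t - c * renewal t\<bar>"
      using integral_revenue[of t] summable_LIMSEQ[OF summable_arrival_cdf[of t]]
      unfolding ER_def renewal_def sums_def by (intro tendsto_rabs tendsto_diff tendsto_mult tendsto_const)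
    show "\<exists>N. \<forall>m\<ge>N. \<bar>(\<Sum>n<m. \<Sum>k\<le>K. early t n k * reward k) - c * (\<Sum>n<m. arrival_cdf t n)\<bar> \<le> C"
      using sum_early_reward[of s reward c] s unfolding C_def by blast
  qed
  have "((\<lambda>t. (ER t - c * renewal t) / t) \<longlongrightarrow> 0) at_top"
  proof (rule Lim_null_comparison)
    show "\<forall>\<^sub>F t in at_top. norm ((ER t - c * renewal t) / t) \<le> C / t"
      using eventually_gt_at_top[of 0]
      by eventually_elim (use bound in \<open>auto simp: intro!: divide_right_mono\<close>)
    show "((\<lambda>t. C / t) \<longlongrightarrow> 0) at_top"
      by (rule tendsto_divide_0[OF tendsto_const])
        (intro filterlim_at_top_imp_at_infinity filterlim_ident)
  qed
  then have "((\<lambda>t. (ER t - c * renewal t) / t + c * (renewal t / t)) \<longlongrightarrow> 0 + c * lam) at_top"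
    by (intro tendsto_add tendsto_mult tendsto_const renewal_tendsto)
  moreover have "(ER t - c * renewal t) / t + c * (renewal t / t) = ER t / t" for t
    by (simp add: diff_divide_distrib)
  ultimately have "((\<lambda>t. ER t / t) \<longlongrightarrow> lam * c) at_top" by (simp add: mult.commute)
  moreover have "(\<lambda>n. \<Sum>k\<le>K. busy_prob n k * reward k) \<longlonglongrightarrow> c"
    by (rule lim[rule_format]) (rule busy_prob_Suc sum_busy_prob)+
  ultimately show ?thesis using that unfolding ER_def by blast
qed

end

subsection \<open>Transfer from the product space\<close>

context pricing_system
begin

lemma random_variable_case_sum: "case_sum U (case_sum S V) i \<in> borel_measurable M"
  using indep by (auto simp: indep_vars_def)

lemma random_variables [measurable]:
  "U n \<in> borel_measurable M" "S n \<in> borel_measurable M" "V n \<in> borel_measurable M"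
  using random_variable_case_sum[of "Inl n"] random_variable_case_sum[of "Inr (Inl n)"]
    random_variable_case_sum[of "Inr (Inr n)"] by simp_all

lemma S_ident: "distr M borel (S n) = distr M borel (S 0)"
proof -
  have "distr M lborel (S n) = distr M lborel (S 0)"
    by (simp only: distributed_distr_eq_density[OF S_exponential])
  moreover have "distr M lborel (S n) = distr M borel (S n)" for n
    by (rule distr_cong) auto
  ultimately show ?thesis by simp
qed

sublocale iid: iid_data "distr M borel (U 0)" "distr M borel (S 0)" "distr M borel (V 0)" lam \<mu>
proof (rule iid_data.intro)
  show "AE y in distr M borel (U 0). 0 \<le> y"
    using U_nonneg[of 0] by (simp add: AE_distr_iff)
  show "integrable (distr M borel (U 0)) (\<lambda>y. y)"
    using U_integrable by (simp add: integrable_distr_eq)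
  show "(\<integral>y. y \<partial>distr M borel (U 0)) = 1 / lam"
    using U_mean by (simp add: integral_distr)
  show "measure (distr M borel (S 0)) {a<..} = exp (- \<mu> * a)" if "0 \<le> a" for a
  proof -
    have "measure (distr M borel (S 0)) {a<..} = measure M {\<omega> \<in> space M. a < S 0 \<omega>}"
      by (subst measure_distr) (auto intro!: arg_cong[where f = "measure M"])
    then show ?thesis
      using exponential_distributedD_gt[OF S_exponential that mu_pos] by (simp add: mult.commute)
  qed
qed (rule prob_space_distr random_variables sets_distr lam_pos mu_pos)+

definition path :: "'a \<Rightarrow> nat + nat + nat \<Rightarrow> real" where
  "path \<omega> i = case_sum U (case_sum S V) i \<omega>"

lemma path_simps [simp]:
  "path \<omega> (Inl n) = U n \<omega>" "path \<omega> (Inr (Inl n)) = S n \<omega>" "path \<omega> (Inr (Inr n)) = V n \<omega>"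
  by (simp_all add: path_def)

text \<open>Independence of the whole family is the same as its joint law being the product of the
  marginals.\<close>

lemma distr_path: "iid.Q = distr M (PiM UNIV (\<lambda>_. borel)) path"
proof -
  have path: "path = (\<lambda>\<omega>. \<lambda>i\<in>UNIV. case_sum U (case_sum S V) i \<omega>)"
    by (intro ext) (simp only: path_def restrict_UNIV)
  have "distr M borel (case_sum U (case_sum S V) i) = iid.D i" for i
    using U_ident S_ident V_ident by (auto simp: iid.D_def split: sum.split)
  then have "iid.Q = PiM UNIV (\<lambda>i. distr M borel (case_sum U (case_sum S V) i))"
    unfolding iid.Q_def by simp
  also have "\<dots> = distr M (PiM UNIV (\<lambda>_. borel)) path"
    unfolding path
    by (rule indep_vars_iff_distr_eq_PiM[THEN iffD1, OF UNIV_not_empty random_variable_case_sum indep, symmetric])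
  finally show ?thesis .
qed

lemma measurable_path: "path \<in> M \<rightarrow>\<^sub>M iid.Q"
proof -
  have "path \<in> M \<rightarrow>\<^sub>M PiM UNIV (\<lambda>_. borel)"
    unfolding path_def[abs_def]
    by (rule measurable_PiM_single') (auto intro: random_variable_case_sum)
  then show ?thesis unfolding distr_path by (simp only: measurable_distr_eq2)
qed

lemma distr_path_Q: "distr M iid.Q path = iid.Q"
proof -
  have "distr M iid.Q path = distr M (PiM UNIV (\<lambda>_. borel)) path"
    by (rule distr_cong) (simp_all only: distr_path sets_distr)
  then show ?thesis by (simp only: distr_path[symmetric])
qed

lemma G_bar_eq: "measure (distr M borel (V 0)) {x..} = G_bar M V x"
  unfolding G_bar_def by (subst measure_distr) (auto intro!: arg_cong[where f = "measure M"])

text \<open>All that the comparison of prices needs, in terms of the original space: the rate as a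
  limit of weighted averages, weights of total mass 1, and a gap \<open>e\<close> below full
  blocking, available once a transition has occurred.\<close>

lemma revenue_rate_limit_weights:
  fixes K :: nat and p :: "nat \<Rightarrow> real"
  defines "b n k \<equiv> measure M {\<omega> \<in> space M. busy K p (\<lambda>i. U i \<omega>) (\<lambda>i. S i \<omega>) (\<lambda>i. V i \<omega>) n = k}"
  shows "\<exists>c e. (\<lambda>n. \<Sum>k<K. b n k * (p k * G_bar M V (p k))) \<longlonglongrightarrow> c \<and>
    revenue_rate M U S V K p = lam * c \<and>
    (\<forall>n. (\<Sum>k\<le>K. b n k) = 1) \<and> 0 < e \<and> (1 \<le> K \<longrightarrow> (\<forall>n. b (Suc n) K \<le> 1 - e))"
proof -
  interpret L: loss_system "distr M borel (U 0)" "distr M borel (S 0)" "distr M borel (V 0)" lam \<mu> K p ..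
  have b: "L.busy_prob n k = b n k" for n k
  proof -
    have "L.busy_prob n k = measure (distr M iid.Q path) {x \<in> space iid.Q. L.Z n x = k}"
      by (simp add: L.busy_prob_def distr_path_Q)
    also have "\<dots> = measure M (path -` {x \<in> space iid.Q. L.Z n x = k} \<inter> space M)"
      by (rule measure_distr[OF measurable_path]) measurable
    finally show ?thesis
      by (auto simp: b_def intro!: arg_cong[where f = "measure M"])
  qed
  have revenue: "(\<integral>x. revenue K p (iid.uu x) (iid.ss x) (iid.vv x) t \<partial>iid.Q) =
    (\<integral>\<omega>. revenue K p (\<lambda>n. U n \<omega>) (\<lambda>n. S n \<omega>) (\<lambda>n. V n \<omega>) t \<partial>M)" for t
  proof -
    have "(\<integral>x. revenue K p (iid.uu x) (iid.ss x) (iid.vv x) t \<partial>distr M iid.Q path) =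
      (\<integral>\<omega>. revenue K p (iid.uu (path \<omega>)) (iid.ss (path \<omega>)) (iid.vv (path \<omega>)) t \<partial>M)"
      by (rule integral_distr[OF measurable_path L.measurable_revenue])
    then show ?thesis by (simp add: distr_path_Q)
  qed
  obtain c where c: "(\<lambda>n. \<Sum>k\<le>K. L.busy_prob n k * L.reward k) \<longlonglongrightarrow> c"
    "((\<lambda>t. (\<integral>x. revenue K p (iid.uu x) (iid.ss x) (iid.vv x) t \<partial>iid.Q) / t) \<longlongrightarrow> lam * c) at_top"
    by (rule L.revenue_rate_limit)
  have "(\<Sum>k\<le>K. L.busy_prob n k * L.reward k) = (\<Sum>k<K. b n k * (p k * G_bar M V (p k)))" for n
    by (simp add: lessThan_Suc_atMost[symmetric] b L.reward_def L.accept_def G_bar_eq)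
  then have "(\<lambda>n. \<Sum>k<K. b n k * (p k * G_bar M V (p k))) \<longlonglongrightarrow> c" using c(1) by simp
  moreover have "revenue_rate M U S V K p = lam * c"
    unfolding revenue_rate_def using c(2) by (intro tendsto_Lim) (auto simp: revenue)
  ultimately show ?thesis
    using L.sum_busy_prob L.empty_prob_pos L.busy_prob_full unfolding b
    by (intro exI[of _ c] exI[of _ L.empty_prob]) auto
qed

text \<open>Makes the optimal value \<open>g\<close> positive, so that it can be divided by and
  \<open>p_inf\<close> cannot be 0.\<close>

lemma ex_G_bar_pos: "\<exists>x>0. 0 < G_bar M V x"
proof (rule ccontr)
  assume "\<not> (\<exists>x>0. 0 < G_bar M V x)"
  then have "G_bar M V x = 0" if "0 < x" for x
    using that by (auto simp: G_bar_def zero_less_measure_iff)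
  then have zero: "prob {\<omega> \<in> space M. 1 / real (Suc n) \<le> V 0 \<omega>} = 0" for n
    by (simp add: G_bar_def)
  have "AE \<omega> in M. V 0 \<omega> < 1 / real (Suc n)" for n
  proof -
    have "AE \<omega> in M. \<omega> \<notin> {\<omega> \<in> space M. 1 / real (Suc n) \<le> V 0 \<omega>}"
      using zero[of n] by (subst (asm) prob_eq_0) auto
    with AE_space show ?thesis by eventually_elim auto
  qed
  then have "AE \<omega> in M. \<forall>n. V 0 \<omega> < 1 / real (Suc n)"
    unfolding AE_all_countable by blast
  then have "AE \<omega> in M. False"
    using V_pos[of 0]
  proof eventually_elim
    case (elim \<omega>)
    obtain n where "1 / real (Suc n) < V 0 \<omega>" using nat_approx_posE[OF \<open>0 < V 0 \<omega>\<close>] by blast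
    moreover have "V 0 \<omega> < 1 / real (Suc n)" using elim by blast
    ultimately show ?case by simp
  qed
  then show False by simp
qed

end

section \<open>Comparison of the optimal prices\<close>

theorem lemma12:
  fixes M :: "'a measure" and lam \<mu> :: real
    and U S V :: "nat \<Rightarrow> 'a \<Rightarrow> real"
    and K :: nat
    and p_inf p_K :: real and p_star :: "nat \<Rightarrow> real"
  assumes "pricing_system M lam \<mu> U S V"
    and "1 \<le> K"
    and "is_arg_max (\<lambda>x. x * G_bar M V x) (\<lambda>x. 0 \<le> x) p_inf"
    and "is_arg_max (\<lambda>x. revenue_rate M U S V K (uniform_price x)) (\<lambda>x. 0 < x) p_K"
    and "is_arg_max (revenue_rate M U S V K) (\<lambda>p. \<forall>k<K. 0 \<le> p k) p_star"
  shows "revenue_rate M U S V K (uniform_price p_K) \<le> revenue_rate M U S V K p_star \<and>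
    revenue_rate M U S V K p_star
      \<le> revenue_rate M U S V K (uniform_price p_K) / (1 - blocking_prob M U S V K p_inf)"
proof
  interpret pricing_system M lam \<mu> U S V by fact
  have "\<forall>k<K. 0 \<le> uniform_price p_K k"
    using assms(4) by (simp add: is_arg_max_def uniform_price_def)
  then show "revenue_rate M U S V K (uniform_price p_K) \<le> revenue_rate M U S V K p_star"
    using assms(5) unfolding is_arg_max_def by (meson not_less)
  define g where "g = p_inf * G_bar M V p_inf"
  have g_max: "x * G_bar M V x \<le> g" if "0 \<le> x" for x
    using assms(3) that by (auto simp: is_arg_max_def g_def not_less)
  obtain x where "0 < x" "0 < G_bar M V x" using ex_G_bar_pos by blast
  then have g_pos: "0 < g" using g_max[of x] by (meson less_imp_le less_le_trans mult_pos_pos)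
  \<comment> \<open>\<open>p_inf\<close> is optimal among prices at least 0, but \<open>p_K\<close>
    competes only with positive ones.\<close>
  then have p_inf: "0 < p_inf"
    using assms(3) by (cases "p_inf = 0") (auto simp: is_arg_max_def g_def)

  have star: "revenue_rate M U S V K p_star \<le> lam * g"
  proof -
    define b where "b n k = measure M {\<omega> \<in> space M.
      busy K p_star (\<lambda>i. U i \<omega>) (\<lambda>i. S i \<omega>) (\<lambda>i. V i \<omega>) n = k}" for n k
    obtain c where lim: "(\<lambda>n. \<Sum>k<K. b n k * (p_star k * G_bar M V (p_star k))) \<longlonglongrightarrow> c"
      and c: "revenue_rate M U S V K p_star = lam * c" and sum: "\<forall>n. (\<Sum>k\<le>K. b n k) = 1"
      using revenue_rate_limit_weights[of K p_star] unfolding b_def by blast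
    have "(\<Sum>k<K. b n k * (p_star k * G_bar M V (p_star k))) \<le> g" for n
    proof -
      have "(\<Sum>k<K. b n k * (p_star k * G_bar M V (p_star k))) \<le> (\<Sum>k<K. b n k * g)"
        using assms(5) by (intro sum_mono mult_left_mono g_max) (auto simp: is_arg_max_def b_def)
      also have "\<dots> \<le> (\<Sum>k\<le>K. b n k * g)"
        using g_pos by (intro sum_mono2) (auto simp: b_def)
      finally show ?thesis using sum[rule_format, of n] by (simp add: sum_distrib_right[symmetric])
    qed
    then have "c \<le> g" using lim by (intro LIMSEQ_le_const2[OF lim]) auto
    then show ?thesis using lam_pos by (simp add: c)
  qed

  define \<pi> where "\<pi> = blocking_prob M U S V K p_inf"
  have uniform: "revenue_rate M U S V K (uniform_price p_inf) = lam * g * (1 - \<pi>)" "\<pi> < 1"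
  proof -
    define b where "b n k = measure M {\<omega> \<in> space M.
      busy K (uniform_price p_inf) (\<lambda>i. U i \<omega>) (\<lambda>i. S i \<omega>) (\<lambda>i. V i \<omega>) n = k}" for n k
    obtain c e where lim: "(\<lambda>n. \<Sum>k<K. b n k * (p_inf * G_bar M V p_inf)) \<longlonglongrightarrow> c"
      and c: "revenue_rate M U S V K (uniform_price p_inf) = lam * c"
      and sum: "\<forall>n. (\<Sum>k\<le>K. b n k) = 1" and e: "0 < e" "\<forall>n. b (Suc n) K \<le> 1 - e"
      using revenue_rate_limit_weights[of K "\<lambda>_. p_inf"] assms(2)
      unfolding b_def uniform_price_def by blast
    have "(\<Sum>k<K. b n k * (p_inf * G_bar M V p_inf)) = (1 - b n K) * g" for n
      using sum[rule_format, of n] by (simp add: lessThan_Suc_atMost[symmetric] g_def sum_distrib_right[symmetric])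
    \<comment> \<open>Convergence of the blocking probabilities is recovered from that of the
      rewards by dividing by \<open>g\<close>; so \<open>lim\<close> is a true limit.\<close>
    then have "(\<lambda>n. 1 - ((1 - b n K) * g) / g) \<longlonglongrightarrow> 1 - c / g"
      using lim g_pos by (intro tendsto_intros) auto
    then have b_lim: "(\<lambda>n. b n K) \<longlonglongrightarrow> 1 - c / g" using g_pos by simp
    then have \<pi>: "\<pi> = 1 - c / g"
      unfolding \<pi>_def blocking_prob_def b_def by (rule limI)
    then show "revenue_rate M U S V K (uniform_price p_inf) = lam * g * (1 - \<pi>)"
      using g_pos by (simp add: c)
    \<comment> \<open>The uniform gap survives the limit and makes the denominator
      \<open>1 - \<pi>\<close> positive.\<close>
    have "1 - c / g \<le> 1 - e"
      by (rule LIMSEQ_le_const2[OF LIMSEQ_Suc[OF b_lim]]) (use e in auto)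
    then show "\<pi> < 1" using \<pi> e by simp
  qed
  have "lam * g * (1 - \<pi>) \<le> revenue_rate M U S V K (uniform_price p_K)"
    using assms(4) p_inf unfolding uniform(1)[symmetric] is_arg_max_def by (meson not_less)
  then have "lam * g \<le> revenue_rate M U S V K (uniform_price p_K) / (1 - \<pi>)"
    using uniform(2) by (simp add: pos_le_divide_eq)
  then show "revenue_rate M U S V K p_star
      \<le> revenue_rate M U S V K (uniform_price p_K) / (1 - blocking_prob M U S V K p_inf)"
    using star by (simp add: \<pi>_def)
qed

end
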